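(* Let $X$ be a metric space and let $n\ge 0$ be an integer. (1) If $X$ has finite capacity dimension, then the following are equivalent: (a) $S^n$ is a small scale Lipschitz extensor of $X$; (b) the capacity dimension of $X$ is at most $n$. (2) If $X$ has finite asymptotic dimension with Higson property, then the following are equivalent: (a) $S^n$ is a large scale Lipschitz extensor of $X$; (b) the asymptotic dimension with Higson property of $X$ is at most $n$.
   Context: A function $f:(X,d_X)\to(Y,d_Y)$ is $\lambda$-Lipschitz if $d_Y(f(x),f(y))\le\lambda\, d_X(x,y)$ for all $x,y$. A metric space $E$ is a large scale Lipschitz extensor (respectively, a small scale Lipschitz extensor) of $X$ if there are constants $C,M>0$ such that, for all $\lambda<M$ (respectively, for all $\lambda>M$), every $\lambda$-Lipschitz function $f:A\to E$, $A$ any subset of $X$, extends to a $C\lambda$-Lipschitz function $\tilde f:X\to E$. $S^n$ is the unit sphere in $\mathbb{R}^{n+1}$ with its usual metric. A family of subsets of a metric space is $r$-disjoint if any two points lying in two different members of the family are at distance at least $r$. The capacity dimension (respectively, the asymptotic dimension with Higson property, also called asymptotic dimension of linear type) of $X$ is at most $n$ if there is $C>0$ such that for all sufficiently small (respectively, all sufficiently large) $r>0$ there is a cover $\mathcal{U}=\bigcup_{i=1}^{n+1}\mathcal{U}_i$ of $X$ such that each $\mathcal{U}_i$ is $r$-disjoint and every element of $\mathcal{U}$ has diameter at most $C r$. Such a dimension is finite if it is at most $k$ for some integer $k\ge0$. *)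

theory Defs
  imports "HOL-Analysis.Analysis"
begin

text \<open>
  A metric space is given as a set in a type of class \<open>metric_space\<close>, with the induced metric.
  The constant \<open>lipschitz_on\<close> includes \<open>0 \<le> L\<close>, so the scales \<open>L\<close> below range over nonnegative reals.
\<close>

definition lipschitz_extension_property ::
    "'a::metric_space set \<Rightarrow> 'b::metric_space set \<Rightarrow> real \<Rightarrow> real \<Rightarrow> bool" where
  "lipschitz_extension_property X E C L \<longleftrightarrow>
     (\<forall>A f. A \<subseteq> X \<and> f \<in> A \<rightarrow> E \<and> L-lipschitz_on A f \<longrightarrow>
        (\<exists>g. g \<in> X \<rightarrow> E \<and> (C * L)-lipschitz_on X g \<and> (\<forall>x\<in>A. g x = f x)))"

definition small_scale_lipschitz_extensor ::
    "'b::metric_space set \<Rightarrow> 'a::metric_space set \<Rightarrow> bool" where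
  "small_scale_lipschitz_extensor E X \<longleftrightarrow>
     (\<exists>C>0. \<exists>M>0. \<forall>L>M. lipschitz_extension_property X E C L)"

definition large_scale_lipschitz_extensor ::
    "'b::metric_space set \<Rightarrow> 'a::metric_space set \<Rightarrow> bool" where
  "large_scale_lipschitz_extensor E X \<longleftrightarrow>
     (\<exists>C>0. \<exists>M>0. \<forall>L<M. lipschitz_extension_property X E C L)"

definition r_disjoint :: "real \<Rightarrow> 'a::metric_space set set \<Rightarrow> bool" where
  "r_disjoint r \<U> \<longleftrightarrow>
     (\<forall>U\<in>\<U>. \<forall>V\<in>\<U>. U \<noteq> V \<longrightarrow> (\<forall>x\<in>U. \<forall>y\<in>V. r \<le> dist x y))"

text \<open>
  The conjunct \<open>bounded U\<close> is needed because \<open>diameter\<close> is a real-valued supremum, hence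
  unspecified on unbounded sets.
\<close>

definition has_cover_at_scale :: "'a::metric_space set \<Rightarrow> nat \<Rightarrow> real \<Rightarrow> real \<Rightarrow> bool" where
  "has_cover_at_scale X n C r \<longleftrightarrow>
     (\<exists>\<U> :: nat \<Rightarrow> 'a set set.
        (\<Union>i\<in>{1..n+1}. \<Union>(\<U> i)) = X \<and>
        (\<forall>i\<in>{1..n+1}. r_disjoint r (\<U> i) \<and>
           (\<forall>U\<in>\<U> i. bounded U \<and> diameter U \<le> C * r)))"

definition capacity_dim_le :: "'a::metric_space set \<Rightarrow> nat \<Rightarrow> bool" where
  "capacity_dim_le X n \<longleftrightarrow>
     (\<exists>C>0. \<forall>\<^sub>F r in at_right 0. has_cover_at_scale X n C r)"

definition asdim_higson_le :: "'a::metric_space set \<Rightarrow> nat \<Rightarrow> bool" where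
  "asdim_higson_le X n \<longleftrightarrow>
     (\<exists>C>0. \<forall>\<^sub>F r in at_top. has_cover_at_scale X n C r)"

definition finite_capacity_dim :: "'a::metric_space set \<Rightarrow> bool" where
  "finite_capacity_dim X \<longleftrightarrow> (\<exists>k. capacity_dim_le X k)"

definition finite_asdim_higson :: "'a::metric_space set \<Rightarrow> bool" where
  "finite_asdim_higson X \<longleftrightarrow> (\<exists>k. asdim_higson_le X k)"

end

theory Submission
  imports Defs
begin

text \<open>
  Both equivalences follow from estimates at a single scale \<open>r\<close>, with Lipschitz constants
  proportional to \<open>1 / r\<close> and ratios depending only on the dimension and on the constants involved.

  Suppose the sphere is an extensor and \<open>Y \<subseteq> X\<close> is covered by \<open>n + 2\<close> coloured
  \<open>r\<close>-disjoint families. The differences of their bump functions define a map into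
  \<open>\<real>\<^sup>n\<^sup>+\<^sup>1\<close> which, where some bump vanishes, stays away from \<open>0\<close>
  and hence projects to the sphere. Extend this projection to \<open>G\<close> on \<open>X\<close> and
  adjoin to the coordinates of \<open>G\<close> a constant coordinate \<open>0\<close>. The resulting
  \<open>n + 2\<close> values always have a gap, which splits the colours into a nonempty set of large ones and a
  nonempty set of small ones. Sorting points by the number of large colours gives only \<open>n + 1\<close> families.
  All large colours have positive bumps, so any one of them confines the pieces to bounded sets. Repeating this on
  \<open>n + 2\<close> of the families at a time removes the superfluous colours one by one.

  Conversely, given \<open>n + 1\<close> coloured families, extend \<open>f\<close> coordinatewise to a map
  \<open>h\<close> into \<open>\<real>\<^sup>n\<^sup>+\<^sup>1\<close>, and
  approximate \<open>h\<close> through a partition of unity with values rounded, for each colour, to a finite net. The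
  nets are chosen in general position, so that one point from each net always gives a basis; hence the approximation
  avoids a ball around \<open>0\<close> whose radius does not depend on \<open>X\<close>. Interpolate
  between \<open>h\<close> near the domain of \<open>f\<close> and this approximation elsewhere, and project to
  the sphere.
\<close>

section \<open>Lipschitz maps and bump functions\<close>

text \<open>Scaled by \<open>norm a\<close>, the difference of the two directions is
  \<open>a - b\<close> plus a vector along \<open>sgn b\<close> that compensates for the difference
  of the norms; each summand has norm at most \<open>dist a b\<close>.\<close>

lemma dist_sgn_le:
  fixes a b :: "'b::real_normed_vector"
  assumes "\<mu> > 0" "norm a \<ge> \<mu>"
  shows "dist (sgn a) (sgn b) \<le> 2 / \<mu> * dist a b"
proof -
  have na: "norm a > 0" using assms by linarith
  have key: "norm a * dist (sgn a) (sgn b) \<le> 2 * dist a b"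
  proof (cases "b = 0")
    case True
    have "norm (sgn a) = 1" using na by (simp add: norm_sgn)
    then show ?thesis using True by (simp add: dist_norm)
  next
    case False
    have "norm a * dist (sgn a) (sgn b) = norm (norm a *\<^sub>R (sgn a - sgn b))"
      by (simp add: dist_norm)
    also have "norm a *\<^sub>R (sgn a - sgn b) = (a - b) + (norm b - norm a) *\<^sub>R sgn b"
      using na False by (simp add: sgn_div_norm algebra_simps)
    also have "norm \<dots> \<le> norm (a - b) + \<bar>norm b - norm a\<bar>"
      by (rule order_trans[OF norm_triangle_ineq]) (simp add: norm_sgn False)
    also have "\<dots> \<le> 2 * dist a b"
      using norm_triangle_ineq3[of b a] by (simp add: dist_norm norm_minus_commute)
    finally show ?thesis .
  qed
  have "\<mu> * dist (sgn a) (sgn b) \<le> norm a * dist (sgn a) (sgn b)"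
    using assms by (intro mult_right_mono) auto
  with key have "\<mu> * dist (sgn a) (sgn b) \<le> 2 * dist a b" by linarith
  then show ?thesis using assms(1) by (simp add: field_simps)
qed

text \<open>McShane's formula: \<open>g\<close> is the infimum of the cones of slope
  \<open>L\<close> with apexes on the graph of \<open>f\<close>. Every cone is
  \<open>L\<close>-Lipschitz, and over \<open>A\<close> no cone dips below the graph.\<close>

lemma mcshane_extension:
  fixes f :: "'a::metric_space \<Rightarrow> real"
  assumes "L-lipschitz_on A f" "A \<noteq> {}"
  obtains g where "L-lipschitz_on UNIV g" "\<And>x. x \<in> A \<Longrightarrow> g x = f x"
proof -
  have L: "L \<ge> 0" and lip: "\<And>x y. x \<in> A \<Longrightarrow> y \<in> A \<Longrightarrow> \<bar>f x - f y\<bar> \<le> L * dist x y"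
    using assms(1) by (auto simp: lipschitz_on_def dist_real_def)
  define g where "g x = (INF a\<in>A. f a + L * dist x a)" for x
  obtain b where b: "b \<in> A" using assms(2) by blast
  have tri: "L * dist x a \<le> L * dist x y + L * dist y a" for x y a
    by (metis L dist_triangle distrib_left mult_left_mono)
  have below: "f b - L * dist x b \<le> f a + L * dist x a" if "a \<in> A" for a x
    using lip[OF that b] tri[of a b x] by (simp add: dist_commute)
  have bdd: "bdd_below ((\<lambda>a. f a + L * dist x a) ` A)" for x
    by (rule bdd_belowI2[where m = "f b - L * dist x b"]) (rule below)
  have half: "g x \<le> g y + L * dist x y" for x y
  proof -
    have "g x - L * dist x y \<le> f a + L * dist y a" if "a \<in> A" for a
    proof -
      have "g x \<le> f a + L * dist x a" unfolding g_def by (rule cINF_lower[OF bdd that])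
      then show ?thesis using tri[of x a y] by simp
    qed
    then have "g x - L * dist x y \<le> g y" unfolding g_def[of y] by (rule cINF_greatest[OF assms(2)])
    then show ?thesis by simp
  qed
  have "L-lipschitz_on UNIV g"
  proof (rule lipschitz_onI[OF _ L])
    fix x y show "dist (g x) (g y) \<le> L * dist x y"
      using half[of x y] half[of y x] by (simp add: dist_real_def dist_commute abs_le_iff)
  qed
  moreover have "g x = f x" if "x \<in> A" for x
  proof (rule antisym)
    show "g x \<le> f x" using cINF_lower[OF bdd that, of x] by (simp add: g_def)
    have "f x \<le> f a + L * dist x a" if "a \<in> A" for a
      using lip[OF \<open>x \<in> A\<close> that] by simp
    then show "f x \<le> g x" unfolding g_def by (rule cINF_greatest[OF assms(2)])
  qed
  ultimately show ?thesis using that by blast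
qed

lemma lipschitz_on_vec:
  fixes g :: "'a::metric_space \<Rightarrow> real ^ 'm::finite" and L :: real
  assumes "\<And>i. L-lipschitz_on S (\<lambda>x. g x $ i)"
  shows "(CARD('m) * L)-lipschitz_on S g"
proof (rule lipschitz_onI)
  have "L \<ge> 0" using assms by (auto simp: lipschitz_on_def)
  then show "0 \<le> real CARD('m) * L" by simp
  fix x y assume "x \<in> S" "y \<in> S"
  have "dist (g x) (g y) \<le> (\<Sum>i\<in>UNIV. \<bar>(g x - g y) $ i\<bar>)"
    unfolding dist_norm by (rule norm_le_l1_cart)
  also have "\<dots> \<le> (\<Sum>i\<in>(UNIV::'m set). L * dist x y)"
    by (rule sum_mono)
       (use assms \<open>x \<in> S\<close> \<open>y \<in> S\<close> in \<open>auto simp: lipschitz_on_def dist_real_def\<close>)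
  finally show "dist (g x) (g y) \<le> real CARD('m) * L * dist x y" by simp
qed

text \<open>Each coordinate is extended separately and then clamped to [-1, 1]. Clamping does not
  increase distances and leaves the values on \<open>A\<close> alone; the factor
  \<open>CARD('m)\<close> is the price of passing through the l1 norm.\<close>

lemma lipschitz_extension_vec:
  fixes f :: "'a::metric_space \<Rightarrow> real ^ 'm::finite" and L :: real
  assumes f: "L-lipschitz_on A f" "A \<noteq> {}" "\<And>x. x \<in> A \<Longrightarrow> norm (f x) \<le> 1"
  obtains g where "(CARD('m) * L)-lipschitz_on UNIV g" "\<And>x. x \<in> A \<Longrightarrow> g x = f x"
    "\<And>x. norm (g x) \<le> CARD('m)"
proof -
  have "\<exists>h. L-lipschitz_on UNIV h \<and> (\<forall>x\<in>A. h x = f x $ i)" for i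
  proof -
    have "L-lipschitz_on A (\<lambda>x. f x $ i)"
      using f(1) unfolding lipschitz_on_def
      by (meson dist_vec_nth_le order_trans)
    from mcshane_extension[OF this f(2)] show ?thesis by metis
  qed
  then obtain h where h: "\<And>i. L-lipschitz_on UNIV (h i)" "\<And>i x. x \<in> A \<Longrightarrow> h i x = f x $ i"
    by metis
  define g :: "'a \<Rightarrow> real ^ 'm" where "g x = (\<chi> i. max (- 1) (min 1 (h i x)))" for x
  have "L-lipschitz_on UNIV (\<lambda>x. g x $ i)" for i
  proof (rule lipschitz_onI)
    show "0 \<le> L" using h by (auto simp: lipschitz_on_def)
    fix x y
    have "dist (g x $ i) (g y $ i) \<le> dist (h i x) (h i y)"
      by (auto simp: g_def dist_real_def)
    then show "dist (g x $ i) (g y $ i) \<le> L * dist x y"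
      using lipschitz_onD[OF h(1)[of i], of x y] by simp
  qed
  then have "(CARD('m) * L)-lipschitz_on UNIV g" by (rule lipschitz_on_vec)
  moreover have "g x = f x" if "x \<in> A" for x
  proof -
    have "\<bar>f x $ i\<bar> \<le> 1" for i
      using component_le_norm_cart[of "f x" i] f(3)[OF that] by linarith
    then have "max (- 1) (min 1 (f x $ i)) = f x $ i" for i by (metis abs_le_iff max.absorb2 min.absorb2 minus_le_iff)
    then show ?thesis using h(2)[OF that] by (simp add: g_def vec_eq_iff)
  qed
  moreover have "norm (g x) \<le> CARD('m)" for x
  proof -
    have "norm (g x) \<le> (\<Sum>i\<in>UNIV. \<bar>g x $ i\<bar>)" by (rule norm_le_l1_cart)
    also have "\<dots> \<le> (\<Sum>i\<in>(UNIV::'m set). 1)" by (rule sum_mono) (auto simp: g_def)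
    finally show ?thesis by simp
  qed
  ultimately show ?thesis using that by blast
qed

text \<open>The case distinction is needed because \<open>infdist x {} = 0\<close>.\<close>

definition bump :: "real \<Rightarrow> 'a::metric_space set set \<Rightarrow> 'a \<Rightarrow> real" where
  "bump r \<U> x = (if \<Union>\<U> = {} then 0 else max 0 (r / 3 - infdist x (\<Union>\<U>)))"

lemma bump_nonneg: "bump r \<U> x \<ge> 0"
  by (simp add: bump_def)

lemma bump_lipschitz: "\<bar>bump r \<U> x - bump r \<U> y\<bar> \<le> dist x y"
  using infdist_triangle_abs[of x "\<Union>\<U>" y] by (auto simp: bump_def)

lemma bump_eq: "x \<in> \<Union>\<U> \<Longrightarrow> r \<ge> 0 \<Longrightarrow> bump r \<U> x = r / 3"
  by (auto simp: bump_def)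

lemma bump_pos:
  assumes "bump r \<U> x > 0"
  shows "\<exists>U\<in>\<U>. \<exists>u\<in>U. dist x u < r / 3"
proof -
  have "\<Union>\<U> \<noteq> {}" "infdist x (\<Union>\<U>) < r / 3"
    using assms by (auto simp: bump_def split: if_splits)
  then obtain u where "u \<in> \<Union>\<U>" "dist x u < r / 3"
    by (metis infdist_notempty cINF_less_iff bdd_belowI2 zero_le_dist)
  then show ?thesis by auto
qed

text \<open>This is why bumps have width \<open>r / 3\<close>: two enlargements use up two thirds of
  the separation and leave one third.\<close>

lemma r_disjoint_thickening:
  assumes "r_disjoint r \<U>" "U \<in> \<U>" "V \<in> \<U>" "U \<noteq> V"
    "u \<in> U" "v \<in> V" "dist x u < r / 3" "dist y v < r / 3"
  shows "dist x y \<ge> r / 3"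
proof -
  have "r \<le> dist u v" using assms by (auto simp: r_disjoint_def)
  also have "dist u v \<le> dist x u + dist x y + dist y v"
    by metric
  finally show ?thesis using assms by linarith
qed

text \<open>Pigeonhole: the range from \<open>y q\<close> to \<open>y q + s\<close> is cut into as
  many intervals as there are indices. One of them contains no value in its interior, and
  \<open>S\<close> collects the indices above it.\<close>

lemma gap_partition:
  fixes y :: "'i::finite \<Rightarrow> real"
  assumes "y p - y q \<ge> s" "s > 0"
  obtains S where "p \<in> S" "q \<notin> S" "\<And>i j. i \<in> S \<Longrightarrow> j \<notin> S \<Longrightarrow> y i - y j \<ge> s / CARD('i)"
proof -
  define M where "M = CARD('i)"
  have M: "M > 0" by (simp add: M_def)
  define t where "t k = y q + real k * (s / M)" for k
  have tS: "t (Suc k) = t k + s / M" for k by (simp add: t_def algebra_simps add_divide_distrib)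
  have tmono: "t k \<le> t l" if "k \<le> l" for k l
    using that assms(2) unfolding t_def by (simp add: divide_right_mono mult_right_mono)
  \<comment> \<open>The value \<open>y q\<close> lies in none of the \<open>M\<close> disjoint open intervals between consecutive thresholds.\<close>
  have "\<exists>k<M. \<forall>i. \<not> (t k < y i \<and> y i < t (Suc k))"
  proof (rule ccontr)
    assume "\<not> ?thesis"
    then obtain e where e: "\<And>k. k < M \<Longrightarrow> t k < y (e k) \<and> y (e k) < t (Suc k)" by metis
    have "inj_on e {..<M}"
    proof (rule linorder_inj_onI')
      fix k l assume "k \<in> {..<M}" "l \<in> {..<M}" "k < l"
      then have "y (e k) < t (Suc k)" "t l < y (e l)" "t (Suc k) \<le> t l"
        using e by (auto intro: tmono)
      then show "e k \<noteq> e l" by fastforce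
    qed
    then have "card (e ` {..<M}) = CARD('i)" by (simp add: card_image M_def)
    then have "e ` {..<M} = UNIV" by (intro card_subset_eq) auto
    then obtain k where "k < M" "q = e k" by (metis UNIV_I imageE lessThan_iff)
    then have "t k < y q" using e by metis
    moreover have "t 0 \<le> t k" by (rule tmono) simp
    ultimately show False by (simp add: t_def)
  qed
  then obtain k where k: "k < M" "\<And>i. t k < y i \<Longrightarrow> y i \<ge> t (Suc k)" by force
  have "t (Suc k) \<le> t M" using k by (intro tmono) simp
  also have "t M \<le> y p" using assms M by (simp add: t_def)
  finally have p: "t (Suc k) \<le> y p" .
  have q: "y q \<le> t k" using tmono[of 0 k] by (simp add: t_def)
  show ?thesis
  proof
    show "p \<in> {i. t k < y i}" using p tS[of k] assms M
      by (smt (verit) divide_pos_pos mem_Collect_eq of_nat_0_less_iff)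
    show "q \<notin> {i. t k < y i}" using q by simp
    show "y i - y j \<ge> s / CARD('i)" if "i \<in> {i. t k < y i}" "j \<notin> {i. t k < y i}" for i j
      using k(2)[of i] tS[of k] that by (simp add: M_def)
  qed
qed

section \<open>Removing a colour\<close>

text \<open>
  Below, \<open>1 / (N * (N + 1))\<close> is the guaranteed gap and \<open>24 * N * C / r\<close> the Lipschitz constant
  of the extended map; \<open>1 / 3\<close> comes from the width of the bump functions.
\<close>

definition disjointness_factor :: "nat \<Rightarrow> real \<Rightarrow> real" where
  "disjointness_factor N C = min (1/3) (1 / (24 * C * real N ^ 2 * (real N + 1)))"

lemma disjointness_factor_bounds:
  assumes "N > 0" "C > 0"
  shows "disjointness_factor N C > 0" "disjointness_factor N C \<le> 1"
  using assms by (auto simp: disjointness_factor_def)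

text \<open>There are \<open>CARD('m) + 1\<close> colours; \<open>None\<close> is the reference
  colour whose bump is subtracted from the others. Only a part \<open>Y\<close> is covered, so that
  further colours of a cover of \<open>X\<close> can be left untouched.\<close>

lemma reduce_families:
  fixes X Y :: "'a::metric_space set" and \<U> :: "'m::finite option \<Rightarrow> 'a set set"
  assumes ext: "lipschitz_extension_property X (sphere (0 :: real ^ 'm) 1) C (24 * CARD('m) / r)"
    and pos: "C > 0" "r > 0"
    and Y: "Y \<subseteq> X" "Y \<subseteq> (\<Union>i. \<Union>(\<U> i))"
    and disj: "\<And>i. r_disjoint r (\<U> i)"
    and diam: "\<And>i U x y. U \<in> \<U> i \<Longrightarrow> x \<in> U \<Longrightarrow> y \<in> U \<Longrightarrow> dist x y \<le> D"
  obtains \<V> :: "nat \<Rightarrow> 'a set set" where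
    "(\<Union>k\<in>{1..CARD('m)}. \<Union>(\<V> k)) = Y"
    "\<And>k. r_disjoint (disjointness_factor CARD('m) C * r) (\<V> k)"
    "\<And>k V x y. V \<in> \<V> k \<Longrightarrow> x \<in> V \<Longrightarrow> y \<in> V \<Longrightarrow> dist x y \<le> D + r"
proof -
  define N where "N = real CARD('m)"
  have N: "N > 0" by (simp add: N_def)
  \<comment> \<open>Projection to the sphere costs \<open>2 / (r / 6)\<close>, and \<open>h\<close>
    is \<open>2 * N\<close>-Lipschitz.\<close>
  define K where "K = 24 * N"
  define f where "f i = bump r (\<U> i)" for i
  \<comment> \<open>The direction of \<open>h\<close> is prescribed only here. On the rest of
    \<open>Y\<close> all bumps are positive, so any value of the extension will do.\<close>
  define A where "A = {x \<in> Y. \<exists>i. f i x = 0}"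
  define h :: "'a \<Rightarrow> real ^ 'm" where "h x = (\<chi> j. f (Some j) x - f None x)" for x
  have f0: "f i x \<ge> 0" for i x by (simp add: f_def bump_nonneg)
  \<comment> \<open>One bump is 0 and another is \<open>r / 3\<close>, so the reference bump differs
    from one of them by at least \<open>r / 6\<close>.\<close>
  have h_lower: "norm (h x) \<ge> r / 6" if x: "x \<in> A" for x
  proof -
    obtain i where i: "f i x = 0" using x by (auto simp: A_def)
    have "x \<in> Y" using x by (simp add: A_def)
    with Y(2) obtain j where "x \<in> \<Union>(\<U> j)" by blast
    then have j: "f j x = r / 3" using pos by (simp add: f_def bump_eq)
    have comp: "\<bar>f (Some k) x - f None x\<bar> \<le> norm (h x)" for k
      using component_le_norm_cart[of "h x" k] by (simp add: h_def)
    have "\<bar>f a x - f None x\<bar> \<le> norm (h x)" for a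
      using comp by (cases a) auto
    from this[of i] this[of j] show ?thesis using i j f0[of None x] by linarith
  qed
  have h_lip: "(real CARD('m) * 2)-lipschitz_on UNIV h"
  proof (rule lipschitz_on_vec, rule lipschitz_onI)
    fix i x y
    show "dist (h x $ i) (h y $ i) \<le> 2 * dist x y"
      using bump_lipschitz[of r "\<U> (Some i)" x y] bump_lipschitz[of r "\<U> None" x y]
      by (simp add: h_def f_def dist_real_def)
  qed simp
  have "(K / r)-lipschitz_on A (\<lambda>x. sgn (h x))"
  proof (rule lipschitz_onI)
    fix x y assume "x \<in> A" "y \<in> A"
    have "dist (sgn (h x)) (sgn (h y)) \<le> 2 / (r / 6) * dist (h x) (h y)"
      using pos h_lower[OF \<open>x \<in> A\<close>] by (intro dist_sgn_le) auto
    also have "\<dots> \<le> 2 / (r / 6) * (N * 2 * dist x y)"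
      using lipschitz_onD[OF h_lip, of x y] pos by (intro mult_left_mono) (auto simp: N_def)
    finally show "dist (sgn (h x)) (sgn (h y)) \<le> K / r * dist x y"
      by (simp add: K_def)
  qed (use N pos in \<open>simp add: K_def\<close>)
  moreover have "(\<lambda>x. sgn (h x)) \<in> A \<rightarrow> sphere 0 1"
  proof
    fix x assume "x \<in> A"
    then have "h x \<noteq> 0" using h_lower[of x] pos by auto
    then show "sgn (h x) \<in> sphere 0 1" by (simp add: norm_sgn)
  qed
  moreover have "A \<subseteq> X" using Y(1) by (auto simp: A_def)
  ultimately have "\<exists>G. G \<in> X \<rightarrow> sphere (0 :: real ^ 'm) 1 \<and>
      (C * (K / r))-lipschitz_on X G \<and> (\<forall>x\<in>A. G x = sgn (h x))"
    using ext[unfolded lipschitz_extension_property_def, rule_format, of A "\<lambda>x. sgn (h x)"]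
    by (simp add: K_def N_def)
  then obtain G where G: "G \<in> X \<rightarrow> sphere (0 :: real ^ 'm) 1"
      "(C * (K / r))-lipschitz_on X G" "\<And>x. x \<in> A \<Longrightarrow> G x = sgn (h x)"
    by blast
  \<comment> \<open>The value 0 at \<open>None\<close> matches \<open>f None - f None\<close>: on
    \<open>A\<close>, every \<open>y x a\<close> is the bump difference
    \<open>f a x - f None x\<close> divided by \<open>norm (h x)\<close>, so \<open>y x\<close>
    orders the colours as the bumps do.\<close>
  define y where "y x a = (case a of None \<Rightarrow> 0 | Some j \<Rightarrow> G x $ j)" for x a
  have y_lip: "\<bar>y x a - y x' a\<bar> \<le> C * (K / r) * dist x x'" if "x \<in> X" "x' \<in> X" for x x' a
  proof (cases a)
    case None
    then show ?thesis using pos N by (simp add: y_def K_def)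
  next
    case (Some j)
    have "\<bar>y x a - y x' a\<bar> \<le> dist (G x) (G x')"
      using dist_vec_nth_le[of "G x" j "G x'"] by (simp add: y_def Some dist_real_def)
    then show ?thesis using lipschitz_onD[OF G(2) that] by linarith
  qed
  define \<delta> where "\<delta> = 1 / N / (N + 1)"
  have \<delta>: "\<delta> > 0" using N by (simp add: \<delta>_def)
  define W where "W S = {x \<in> Y. \<forall>i\<in>S. \<forall>j\<in>-S. y x i - y x j \<ge> \<delta>}" for S
  \<comment> \<open>A unit vector has a coordinate of modulus at least \<open>1 / N\<close>.
    Compared with the 0 at \<open>None\<close> it gives a spread of \<open>1 / N\<close>, hence a
    gap \<open>\<delta>\<close> among the \<open>N + 1\<close> values.\<close>
  have gap: "\<exists>S. S \<noteq> {} \<and> S \<noteq> UNIV \<and> x \<in> W S" if "x \<in> Y" for x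
  proof -
    have n1: "norm (G x) = 1" using G(1) Y(1) that by (auto simp: Pi_iff)
    have "\<exists>j. \<bar>G x $ j\<bar> \<ge> 1 / N"
    proof (rule ccontr)
      assume "\<not> ?thesis"
      then have "(\<Sum>j\<in>UNIV. \<bar>G x $ j\<bar>) < (\<Sum>j\<in>(UNIV::'m set). 1 / N)"
        by (intro sum_strict_mono) (auto simp: not_le)
      then show False using norm_le_l1_cart[of "G x"] n1 N by (simp add: N_def)
    qed
    then obtain j where "\<bar>G x $ j\<bar> \<ge> 1 / N" by blast
    then have "\<exists>p q. y x p - y x q \<ge> 1 / N"
    proof (cases "G x $ j \<ge> 0")
      case True
      then have "y x (Some j) - y x None \<ge> 1 / N"
        using \<open>\<bar>G x $ j\<bar> \<ge> 1 / N\<close> by (simp add: y_def)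
      then show ?thesis by blast
    next
      case False
      then have "y x None - y x (Some j) \<ge> 1 / N"
        using \<open>\<bar>G x $ j\<bar> \<ge> 1 / N\<close> by (simp add: y_def)
      then show ?thesis by blast
    qed
    then obtain p q where pq: "y x p - y x q \<ge> 1 / N" by blast
    have "1 / N > 0" using N by simp
    obtain S where "p \<in> S" "q \<notin> S"
      "\<And>i j. i \<in> S \<Longrightarrow> j \<notin> S \<Longrightarrow> y x i - y x j \<ge> 1 / N / CARD('m option)"
      by (rule gap_partition[of "1 / N" "y x" p q, OF pq \<open>1 / N > 0\<close>]) blast
    then have "x \<in> W S" using that by (simp add: W_def \<delta>_def N_def add.commute)
    with \<open>p \<in> S\<close> \<open>q \<notin> S\<close> show ?thesis by blast
  qed
  \<comment> \<open>Off \<open>A\<close> all bumps are positive. On \<open>A\<close>, the bump of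
    \<open>i\<close> exceeds the nonnegative bump of some colour outside \<open>S\<close>.\<close>
  have f_pos: "f i x > 0" if W: "x \<in> W S" "i \<in> S" "S \<noteq> UNIV" for x S i
  proof (cases "x \<in> A")
    case False
    then show ?thesis using that f0[of i x] by (auto simp: A_def W_def less_le)
  next
    case True
    obtain j where j: "j \<notin> S" using W(3) by blast
    have "y x i - y x j \<ge> \<delta>" using that j by (auto simp: W_def)
    moreover have "y x a = (f a x - f None x) / norm (h x)" for a
      using G(3)[OF True] by (cases a) (simp_all add: y_def h_def sgn_div_norm divide_inverse)
    ultimately have "(f i x - f j x) / norm (h x) > 0" using \<delta> by (simp add: diff_divide_distrib)
    then have "f i x - f j x > 0" using norm_ge_zero[of "h x"]
      by (metis zero_less_divide_iff not_le)
    then show ?thesis using f0[of j x] by linarith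
  qed
  define nb where "nb U = {x. \<exists>u\<in>U. dist x u < r / 3}" for U :: "'a set"
  define ch where "ch S = (SOME i. i \<in> S)" for S :: "'m option set"
  have ch: "ch S \<in> S" if "S \<noteq> {}" for S using that unfolding ch_def by (simp add: some_in_eq)
  \<comment> \<open>A single colour of \<open>S\<close> suffices to localise \<open>W S\<close>: its
    bump is positive there, so the neighbourhoods of its sets cover \<open>W S\<close>.\<close>
  define \<V> where "\<V> k = {W S \<inter> nb U | S U. card S = k \<and> S \<noteq> {} \<and> S \<noteq> UNIV \<and> U \<in> \<U> (ch S)}" for k
  have "(\<Union>k\<in>{1..CARD('m)}. \<Union>(\<V> k)) = Y"
  proof (rule antisym)
    show "(\<Union>k\<in>{1..CARD('m)}. \<Union>(\<V> k)) \<subseteq> Y" by (auto simp: \<V>_def W_def)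
    show "Y \<subseteq> (\<Union>k\<in>{1..CARD('m)}. \<Union>(\<V> k))"
    proof
      fix x assume "x \<in> Y"
      from gap[OF this] obtain S where S: "S \<noteq> {}" "S \<noteq> UNIV" "x \<in> W S" by blast
      have "f (ch S) x > 0" using f_pos S ch by blast
      then obtain U where U: "U \<in> \<U> (ch S)" "x \<in> nb U"
        using bump_pos unfolding f_def nb_def by blast
      \<comment> \<open>Here the colour disappears: a nonempty proper subset of \<open>N + 1\<close>
        colours has between 1 and \<open>N\<close> elements.\<close>
      have "card S < CARD('m option)" using S(2) by (intro psubset_card_mono) auto
      moreover have "card S > 0" using S(1) by (simp add: card_gt_0_iff)
      ultimately have "card S \<in> {1..CARD('m)}" by auto
      moreover have "W S \<inter> nb U \<in> \<V> (card S)" using S U by (auto simp: \<V>_def)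
      ultimately show "x \<in> (\<Union>k\<in>{1..CARD('m)}. \<Union>(\<V> k))" using S(3) U(2) by blast
    qed
  qed
  moreover have "r_disjoint (disjointness_factor CARD('m) C * r) (\<V> k)" for k
    unfolding r_disjoint_def
  proof (intro ballI impI)
    fix V V' x x' assume V: "V \<in> \<V> k" "V' \<in> \<V> k" "V \<noteq> V'" "x \<in> V" "x' \<in> V'"
    obtain S U where S: "V = W S \<inter> nb U" "card S = k" "S \<noteq> {}" "S \<noteq> UNIV" "U \<in> \<U> (ch S)"
      using V(1) by (auto simp: \<V>_def)
    obtain S' U' where S': "V' = W S' \<inter> nb U'" "card S' = k" "S' \<noteq> {}" "S' \<noteq> UNIV" "U' \<in> \<U> (ch S')"
      using V(2) by (auto simp: \<V>_def)
    show "disjointness_factor CARD('m) C * r \<le> dist x x'"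
    proof (cases "S = S'")
      case True
      then have "U \<noteq> U'" using V S S' by auto
      then have "r / 3 \<le> dist x x'"
        using r_disjoint_thickening[OF disj] S S' V True unfolding nb_def by blast
      moreover have "disjointness_factor CARD('m) C * r \<le> 1 / 3 * r"
        using pos by (intro mult_right_mono) (auto simp: disjointness_factor_def)
      ultimately show ?thesis by simp
    next
      case False
      \<comment> \<open>Distinct sets of equal cardinality are incomparable. Hence two colours swap
        order between \<open>x\<close> and \<open>x'\<close>, and the Lipschitz values
        \<open>y\<close> need a definite distance to undo a gap and open the opposite one.\<close>
      have "\<not> S \<subseteq> S'" using False S(2) S'(2) by (metis card_subset_eq finite)
      moreover have "\<not> S' \<subseteq> S" using False S(2) S'(2) by (metis card_subset_eq finite)
      ultimately obtain i j where ij: "i \<in> S" "i \<notin> S'" "j \<in> S'" "j \<notin> S" by blast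
      have "y x i - y x j \<ge> \<delta>" "y x' j - y x' i \<ge> \<delta>" and XX: "x \<in> X" "x' \<in> X"
        using V S S' ij Y by (auto simp: W_def)
      then have "\<delta> \<le> C * (K / r) * dist x x'"
        using y_lip[OF XX, of i] y_lip[OF XX, of j] by linarith
      then have "\<delta> * r / (C * K) \<le> dist x x'"
        using pos N by (simp add: K_def field_simps)
      moreover have "disjointness_factor CARD('m) C * r \<le> \<delta> / (C * K) * r"
        using pos by (intro mult_right_mono)
          (auto simp: disjointness_factor_def \<delta>_def K_def N_def power2_eq_square field_simps)
      ultimately show ?thesis by simp
    qed
  qed
  moreover have "dist x x' \<le> D + r" if V: "V \<in> \<V> k" "x \<in> V" "x' \<in> V" for k V x x'
  proof -
    obtain S U where S: "V = W S \<inter> nb U" "U \<in> \<U> (ch S)" using V(1) by (auto simp: \<V>_def)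
    then obtain u u' where u: "u \<in> U" "dist x u < r / 3" "u' \<in> U" "dist x' u' < r / 3"
      using V by (auto simp: nb_def)
    have "dist x x' \<le> dist x u + dist u u' + dist x' u'" by metric
    then show ?thesis using diam[OF S(2) u(1,3)] u pos by linarith
  qed
  ultimately show ?thesis using that by blast
qed

section \<open>Nets in general position\<close>

text \<open>The last clause says that one point from each net always gives linearly independent
  vectors. The index set is a parameter so that nets can be added one at a time.\<close>

definition generic_nets :: "real \<Rightarrow> real \<Rightarrow> 'm set \<Rightarrow> ('m::finite \<Rightarrow> (real ^ 'm) set) \<Rightarrow> bool" where
  "generic_nets R \<epsilon> I V \<longleftrightarrow>
    (\<forall>i\<in>I. finite (V i) \<and> (\<forall>z. norm z \<le> R \<longrightarrow> (\<exists>v\<in>V i. dist z v \<le> \<epsilon>)) \<and>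
            (\<forall>v\<in>V i. norm v \<le> R + \<epsilon>)) \<and>
    (\<forall>v\<in>Pi\<^sub>E I V. \<forall>\<phi>. (\<Sum>i\<in>I. \<phi> i *\<^sub>R v i) = 0 \<longrightarrow> (\<forall>i\<in>I. \<phi> i = 0))"

text \<open>A selection from the earlier nets has fewer than \<open>CARD('m)\<close> vectors, so its
  span is negligible, and so is the finite union \<open>B\<close> of these spans. A new net avoiding
  \<open>B\<close> forces its own coefficient in a vanishing combination to be 0, and the induction
  hypothesis handles the rest.\<close>

lemma ex_generic_nets:
  fixes I :: "'m::finite set"
  assumes "\<epsilon> > 0"
  shows "\<exists>V. generic_nets R \<epsilon> I V"
  using finite[of I]
proof (induction I rule: finite_induct)
  case empty
  then show ?case by (simp add: generic_nets_def)
next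
  case (insert k I)
  from insert.IH obtain V where gV: "generic_nets R \<epsilon> I V" by (elim exE)
  then have V: "\<And>i. i \<in> I \<Longrightarrow> finite (V i)"
       "\<And>i z. i \<in> I \<Longrightarrow> norm z \<le> R \<Longrightarrow> \<exists>v\<in>V i. dist z v \<le> \<epsilon>"
       "\<And>i v. i \<in> I \<Longrightarrow> v \<in> V i \<Longrightarrow> norm v \<le> R + \<epsilon>"
       "\<And>v \<phi> i. v \<in> Pi\<^sub>E I V \<Longrightarrow> (\<Sum>i\<in>I. \<phi> i *\<^sub>R v i) = 0 \<Longrightarrow> i \<in> I \<Longrightarrow> \<phi> i = 0"
    unfolding generic_nets_def by blast+
  define B where "B = (\<Union>v\<in>Pi\<^sub>E I V. span (v ` I))"
  have "negligible (span (v ` I))" for v :: "'m \<Rightarrow> real ^ 'm"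
  proof (rule negligible_lowdim)
    have "dim (span (v ` I)) \<le> card (v ` I)" using dim_le_card'[of "v ` I"] by simp
    also have "\<dots> \<le> card I" by (rule card_image_le) simp
    also have "\<dots> < CARD('m)" using insert.hyps by (intro psubset_card_mono) auto
    finally show "dim (span (v ` I)) < DIM(real ^ 'm)" by simp
  qed
  moreover have "finite (Pi\<^sub>E I V)" using V(1) by (intro finite_PiE) auto
  ultimately have "negligible B" unfolding B_def by (intro negligible_Union) auto
  then have "\<not> ball z (\<epsilon> / 2) \<subseteq> B" for z
    using open_not_negligible[of "ball z (\<epsilon> / 2)"] negligible_subset assms by auto
  then have "\<exists>p. p \<in> ball z (\<epsilon> / 2) \<and> p \<notin> B" for z by blast
  \<comment> \<open>Half of \<open>\<epsilon>\<close> pays for moving \<open>z\<close> off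
    \<open>B\<close>, the other half for the finite subcover of the ball.\<close>
  then obtain w where w: "\<And>z. w z \<in> ball z (\<epsilon> / 2)" "\<And>z. w z \<notin> B" by metis
  have "cball (0 :: real ^ 'm) R \<subseteq> (\<Union>z\<in>cball 0 R. ball z (\<epsilon> / 2))" using assms by force
  then obtain Z where Z: "finite Z" "Z \<subseteq> cball (0 :: real ^ 'm) R" "cball 0 R \<subseteq> (\<Union>z\<in>Z. ball z (\<epsilon> / 2))"
    by (rule compactE_image[OF compact_cball open_ball]) blast
  define V' where "V' = V(k := w ` Z)"
  have V'I: "V' i = V i" if "i \<in> I" for i using that insert.hyps by (auto simp: V'_def)
  have "finite (V' i) \<and> (\<forall>z. norm z \<le> R \<longrightarrow> (\<exists>v\<in>V' i. dist z v \<le> \<epsilon>)) \<and>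
            (\<forall>v\<in>V' i. norm v \<le> R + \<epsilon>)" if i: "i \<in> insert k I" for i
  proof (cases "i \<in> I")
    case True
    then show ?thesis using V(1-3) V'I by auto
  next
    case False
    then have [simp]: "V' i = w ` Z" using i by (simp add: V'_def)
    have "\<exists>v\<in>V' i. dist x v \<le> \<epsilon>" if x: "norm x \<le> R" for x
    proof -
      obtain z where "z \<in> Z" "dist z x < \<epsilon> / 2" using Z(3) x by (auto simp: subset_iff)
      moreover have "dist z (w z) < \<epsilon> / 2" using w(1)[of z] by simp
      moreover have "dist x (w z) \<le> dist z x + dist z (w z)" by metric
      ultimately have "dist x (w z) \<le> \<epsilon>" by linarith
      then show ?thesis using \<open>z \<in> Z\<close> by auto
    qed
    moreover have "norm (w z) \<le> R + \<epsilon>" if "z \<in> Z" for z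
    proof -
      have "norm (w z) \<le> norm z + dist z (w z)"
        by (metis dist_norm norm_triangle_sub dist_commute)
      then show ?thesis using w(1)[of z] Z(2) that assms by (fastforce simp: subset_iff)
    qed
    ultimately show ?thesis using Z(1) by simp
  qed
  moreover have "\<forall>i\<in>insert k I. \<phi> i = 0"
    if v: "v \<in> Pi\<^sub>E (insert k I) V'" and sum0: "(\<Sum>i\<in>insert k I. \<phi> i *\<^sub>R v i) = 0" for v \<phi>
  proof -
    define v' where "v' = restrict v I"
    have v': "v' \<in> Pi\<^sub>E I V" using v V'I unfolding v'_def by (auto simp: PiE_iff)
    have img: "v' ` I = v ` I" by (auto simp: v'_def)
    have eq: "\<phi> k *\<^sub>R v k = - (\<Sum>i\<in>I. \<phi> i *\<^sub>R v i)"
      using sum0 insert.hyps by (simp add: eq_neg_iff_add_eq_0)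
    have mem: "\<phi> k *\<^sub>R v k \<in> span (v ` I)"
      unfolding eq by (intro span_neg span_sum span_mul span_base) auto
    have k0: "\<phi> k = 0"
    proof (rule ccontr)
      assume "\<phi> k \<noteq> 0"
      then have "v k \<in> span (v ` I)" using span_mul[OF mem, of "inverse (\<phi> k)"] by simp
      then have "v k \<in> B" using v' img unfolding B_def by (metis UN_I)
      moreover have "v k \<in> w ` Z" using v by (auto simp: PiE_iff V'_def)
      ultimately show False using w(2) by auto
    qed
    have "(\<Sum>i\<in>I. \<phi> i *\<^sub>R v' i) = (\<Sum>i\<in>I. \<phi> i *\<^sub>R v i)"
      by (intro sum.cong) (auto simp: v'_def)
    also have "\<dots> = 0" using eq k0 by simp
    finally show ?thesis using V(4)[OF v'] k0 by blast
  qed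
  ultimately have "generic_nets R \<epsilon> (insert k I) V'" unfolding generic_nets_def by (intro conjI ballI allI impI) blast+
  then show ?case by blast
qed

text \<open>For a fixed selection the coefficient map is linear and injective, hence bounded below,
  and coefficients with sum 1 stay away from 0. Finitely many selections allow a common
  bound.\<close>

lemma generic_nets_lower_bound:
  fixes R \<epsilon> :: real
  assumes "\<epsilon> > 0"
  obtains V :: "'m::finite \<Rightarrow> (real ^ 'm) set" and \<eta> :: real where "\<eta> > 0"
    "\<And>i z. norm z \<le> R \<Longrightarrow> \<exists>v\<in>V i. dist z v \<le> \<epsilon>"
    "\<And>i v. v \<in> V i \<Longrightarrow> norm v \<le> R + \<epsilon>"
    "\<And>v \<phi>. (\<And>i. v i \<in> V i) \<Longrightarrow> (\<Sum>i\<in>UNIV. \<phi> i) = 1 \<Longrightarrow> norm (\<Sum>i\<in>UNIV. \<phi> i *\<^sub>R v i) \<ge> \<eta>"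
proof -
  obtain V where gV: "generic_nets R \<epsilon> (UNIV :: 'm set) V"
    using ex_generic_nets[OF assms] by blast
  have V: "\<And>i. finite (V i)"
       "\<And>i z. norm z \<le> R \<Longrightarrow> \<exists>v\<in>V i. dist z v \<le> \<epsilon>"
       "\<And>i v. v \<in> V i \<Longrightarrow> norm v \<le> R + \<epsilon>"
    using gV unfolding generic_nets_def by simp_all
  have V4: "\<phi> i = 0" if "v \<in> Pi\<^sub>E UNIV V" "(\<Sum>i\<in>UNIV. \<phi> i *\<^sub>R v i) = 0" for v \<phi> i
    using gV that unfolding generic_nets_def by blast
  have "\<exists>b>0. \<forall>\<phi>. (\<Sum>i\<in>UNIV. \<phi> i) = 1 \<longrightarrow> b \<le> norm (\<Sum>i\<in>UNIV. \<phi> i *\<^sub>R v i)"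
    if v: "v \<in> Pi\<^sub>E UNIV V" for v
  proof -
    define T :: "real ^ 'm \<Rightarrow> real ^ 'm" where "T p = (\<Sum>i\<in>UNIV. p $ i *\<^sub>R v i)" for p
    have lin: "linear T"
      unfolding T_def
      by (intro linearI) (simp_all add: scaleR_add_left sum.distrib scaleR_sum_right)
    have "inj T"
      using linear_injective_0[OF lin] V4[OF v] by (simp add: T_def vec_eq_iff)
    from linear_inj_bounded_below_pos[OF lin this] obtain b where
      b: "b > 0" "\<And>p. b * norm p \<le> norm (T p)" by auto
    have "b / CARD('m) \<le> norm (\<Sum>i\<in>UNIV. \<phi> i *\<^sub>R v i)" if "(\<Sum>i\<in>UNIV. \<phi> i) = 1" for \<phi>
    proof -
      define p :: "real ^ 'm" where "p = (\<chi> i. \<phi> i)"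
      have "1 \<le> (\<Sum>i\<in>(UNIV::'m set). norm p)"
        unfolding that[symmetric]
        by (intro sum_mono) (use component_le_norm_cart[of p] in \<open>auto simp: p_def abs_le_iff\<close>)
      then have "b * (1 / CARD('m)) \<le> b * norm p"
        using b(1) by (intro mult_left_mono) (auto simp: field_simps)
      also have "\<dots> \<le> norm (T p)" by (rule b(2))
      finally show ?thesis by (simp add: T_def p_def)
    qed
    moreover have "b / CARD('m) > 0" using b(1) by simp
    ultimately show ?thesis by blast
  qed
  then obtain b where b: "\<And>v. v \<in> Pi\<^sub>E UNIV V \<Longrightarrow> b v > 0"
    "\<And>v \<phi>. v \<in> Pi\<^sub>E UNIV V \<Longrightarrow> (\<Sum>i\<in>UNIV. \<phi> i) = 1 \<Longrightarrow> b v \<le> norm (\<Sum>i\<in>UNIV. \<phi> i *\<^sub>R v i)"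
    using bchoice[of "Pi\<^sub>E UNIV V" "\<lambda>v b. b > 0 \<and> (\<forall>\<phi>. (\<Sum>i\<in>UNIV. \<phi> i) = 1 \<longrightarrow> b \<le> norm (\<Sum>i\<in>UNIV. \<phi> i *\<^sub>R v i))"]
    by blast
  \<comment> \<open>Inserting 1 keeps the minimum meaningful if some net is empty.\<close>
  define \<eta> where "\<eta> = Min (insert 1 (b ` Pi\<^sub>E UNIV V))"
  have fin: "finite (insert 1 (b ` Pi\<^sub>E UNIV V))" using V(1) by (simp add: finite_PiE)
  have \<eta>0: "\<eta> > 0" unfolding \<eta>_def using fin b(1) by (subst Min_gr_iff) auto
  have \<eta>1: "\<eta> \<le> norm (\<Sum>i\<in>UNIV. \<phi> i *\<^sub>R v i)"
    if "\<And>i. v i \<in> V i" "(\<Sum>i\<in>UNIV. \<phi> i) = 1" for v \<phi>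
  proof -
    have v: "v \<in> Pi\<^sub>E UNIV V" using that(1) by auto
    then have "\<eta> \<le> b v" unfolding \<eta>_def using fin by (intro Min_le) auto
    then show ?thesis using b(2)[OF v that(2)] by linarith
  qed
  show ?thesis by (rule that[OF \<eta>0 V(2,3) \<eta>1])
qed

section \<open>Extending maps into the sphere\<close>

text \<open>The change of the denominator enters with weight \<open>b' / s' \<le> 1\<close>, so the
  bound divides by \<open>s\<close> only. It serves for the weights of the partition of
  unity.\<close>

lemma quotient_diff_le:
  fixes b b' s s' t :: real
  assumes "\<bar>b - b'\<bar> \<le> t" "\<bar>s - s'\<bar> \<le> M * t" "0 \<le> b'" "b' \<le> s'" "s > 0" "s' > 0"
  shows "\<bar>b / s - b' / s'\<bar> \<le> (M + 1) * t / s"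
proof -
  have "b / s - b' / s' = ((b - b') + (b' / s') * (s' - s)) / s"
    using assms by (simp add: field_simps)
  also have "\<bar>\<dots>\<bar> = \<bar>(b - b') + (b' / s') * (s' - s)\<bar> / s"
    using assms by simp
  also have "\<dots> \<le> (M + 1) * t / s"
  proof (rule divide_right_mono)
    have "\<bar>(b' / s') * (s' - s)\<bar> \<le> 1 * (M * t)"
      unfolding abs_mult using assms by (intro mult_mono) (auto simp: abs_minus_commute)
    then have "\<bar>(b - b') + (b' / s') * (s' - s)\<bar> \<le> t + M * t"
      using assms(1) by linarith
    then show "\<bar>(b - b') + (b' / s') * (s' - s)\<bar> \<le> (M + 1) * t"
      by (simp add: distrib_right add.commute)
  qed (use assms in simp)
  finally show ?thesis .
qed

text \<open>\<open>F\<close> averages vectors that jump from set to set. The average is still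
  Lipschitz, since a vector can change only where its weight vanishes or across a distance of at
  least \<open>r / 3\<close>.\<close>

lemma generic_approximation:
  fixes X :: "'a::metric_space set" and \<U> :: "'m::finite \<Rightarrow> 'a set set"
    and V :: "'m \<Rightarrow> (real ^ 'm) set" and h :: "'a \<Rightarrow> real ^ 'm"
    and r D R \<Lambda> \<epsilon> Q \<eta> :: real
  assumes r: "r > 0" and cover: "X = (\<Union>i. \<Union>(\<U> i))"
    and disj: "\<And>i. r_disjoint r (\<U> i)"
    and diam: "\<And>i U x y. U \<in> \<U> i \<Longrightarrow> x \<in> U \<Longrightarrow> y \<in> U \<Longrightarrow> dist x y \<le> D"
    and h: "\<And>x. norm (h x) \<le> R" "\<Lambda>-lipschitz_on UNIV h"
    and net: "\<And>i z. norm z \<le> R \<Longrightarrow> \<exists>v\<in>V i. dist z v \<le> \<epsilon>"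
    and bound: "\<And>i v. v \<in> V i \<Longrightarrow> norm v \<le> Q"
    and generic: "\<And>v \<phi>. (\<And>i. v i \<in> V i) \<Longrightarrow> (\<Sum>i\<in>UNIV. \<phi> i) = 1 \<Longrightarrow>
      norm (\<Sum>i\<in>UNIV. \<phi> i *\<^sub>R v i) \<ge> \<eta>"
  obtains F where
    "\<And>x. x \<in> X \<Longrightarrow> norm (F x) \<ge> \<eta>"
    "\<And>x. x \<in> X \<Longrightarrow> dist (F x) (h x) \<le> \<Lambda> * (D + r) + \<epsilon>"
    "\<And>x y. x \<in> X \<Longrightarrow> y \<in> X \<Longrightarrow>
      dist (F x) (F y) \<le> real CARD('m) * (6 * (real CARD('m) + 1) * Q / r) * dist x y"
proof -
  define N where "N = real CARD('m)"
  have N: "N \<ge> 1" by (simp add: N_def Suc_leI)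
  define b where "b i = bump r (\<U> i)" for i
  define \<sigma> where "\<sigma> x = (\<Sum>i\<in>UNIV. b i x)" for x
  define \<phi> where "\<phi> x i = b i x / \<sigma> x" for x i
  define near where "near i x U \<longleftrightarrow> U \<in> \<U> i \<and> (\<exists>u\<in>U. dist x u < r / 3)" for i x U
  define sel where "sel i x = (SOME U. near i x U)" for i x
  \<comment> \<open>This depends on \<open>x\<close> only through \<open>sel i x\<close>:
    \<open>h\<close> is sampled at one chosen point of that set and rounded to the net.\<close>
  define v where "v x i = (SOME z. z \<in> V i \<and> dist (h (SOME u. u \<in> sel i x)) z \<le> \<epsilon>)" for x i
  have b0: "b i x \<ge> 0" for i x by (simp add: b_def bump_nonneg)
  have b_le: "b i x \<le> \<sigma> x" for i x
    unfolding \<sigma>_def by (rule member_le_sum) (auto simp: b0)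
  have \<sigma>: "\<sigma> x \<ge> r / 3" if x: "x \<in> X" for x
  proof -
    obtain i where "x \<in> \<Union>(\<U> i)" using x cover by blast
    then have "b i x = r / 3" using r by (simp add: b_def bump_eq)
    then show ?thesis using b_le[of i x] by simp
  qed
  have \<sigma>0: "\<sigma> x > 0" if "x \<in> X" for x using \<sigma>[OF that] r by linarith
  have sel: "near i x (sel i x)" if "b i x > 0" for i x
  proof -
    have "\<exists>U. near i x U" using bump_pos that unfolding b_def near_def by blast
    then show ?thesis unfolding sel_def by (rule someI_ex)
  qed
  have sel_eq: "sel i x = sel i y" if "b i x > 0" "b i y > 0" "dist x y < r / 3" for i x y
  proof (rule ccontr)
    assume ne: "sel i x \<noteq> sel i y"
    have "r / 3 \<le> dist x y"
      using sel[OF that(1)] sel[OF that(2)] r_disjoint_thickening[OF disj _ _ ne]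
      unfolding near_def by blast
    then show False using that(3) by simp
  qed
  \<comment> \<open>Membership in the net holds even where the bump vanishes and
    \<open>sel i x\<close> is arbitrary, so \<open>generic\<close> sees a full selection.\<close>
  have v: "v x i \<in> V i \<and> dist (h (SOME u. u \<in> sel i x)) (v x i) \<le> \<epsilon>" for x i
    unfolding v_def
  proof (rule someI_ex)
    show "\<exists>z. z \<in> V i \<and> dist (h (SOME u. u \<in> sel i x)) z \<le> \<epsilon>"
      using net[OF h(1)] by blast
  qed
  have v_norm: "norm (v x i) \<le> Q" for x i using v bound by blast
  have Q: "Q \<ge> 0" using v_norm[of undefined undefined] norm_ge_zero order_trans by blast
  have \<Lambda>: "\<Lambda> \<ge> 0" using h(2) by (rule lipschitz_on_nonneg)
  have v_close: "dist (v x i) (h x) \<le> \<Lambda> * (D + r) + \<epsilon>" if b: "b i x > 0" for x i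
  proof -
    obtain u where u: "sel i x \<in> \<U> i" "u \<in> sel i x" "dist x u < r / 3"
      using sel[OF b] by (auto simp: near_def)
    define u' where "u' = (SOME u. u \<in> sel i x)"
    have "u' \<in> sel i x" unfolding u'_def using u(2) by (rule someI)
    then have "dist u u' \<le> D" using diam u by blast
    then have "dist u' x \<le> D + r"
      using u(3) r dist_triangle[of x u' u] by (simp add: dist_commute)
    then have "\<Lambda> * dist u' x \<le> \<Lambda> * (D + r)" using \<Lambda> by (rule mult_left_mono)
    moreover have "dist (h u') (h x) \<le> \<Lambda> * dist u' x" using h(2) by (auto simp: lipschitz_on_def)
    moreover have "dist (h u') (v x i) \<le> \<epsilon>" using v unfolding u'_def by blast
    moreover have "dist (v x i) (h x) \<le> dist (h u') (h x) + dist (h u') (v x i)" by metric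
    ultimately show ?thesis by linarith
  qed
  have \<phi>0: "\<phi> x i \<ge> 0" if "x \<in> X" for x i using b0 \<sigma>0[OF that] by (simp add: \<phi>_def)
  have \<phi>1: "(\<Sum>i\<in>UNIV. \<phi> x i) = 1" if "x \<in> X" for x
    using \<sigma>0[OF that] by (simp add: \<phi>_def \<sigma>_def flip: sum_divide_distrib)
  have \<phi>_le1: "\<phi> x i \<le> 1" if "x \<in> X" for x i
    using b_le[of i x] \<sigma>0[OF that] by (simp add: \<phi>_def)
  define F where "F x = (\<Sum>i\<in>UNIV. \<phi> x i *\<^sub>R v x i)" for x
  have F1: "norm (F x) \<ge> \<eta>" if "x \<in> X" for x
    unfolding F_def by (rule generic) (use v \<phi>1[OF that] in auto)
  have F2: "dist (F x) (h x) \<le> \<Lambda> * (D + r) + \<epsilon>" if "x \<in> X" for x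
  proof -
    have "F x - h x = (\<Sum>i\<in>UNIV. \<phi> x i *\<^sub>R v x i) - (\<Sum>i\<in>UNIV. \<phi> x i) *\<^sub>R h x"
      by (simp add: F_def \<phi>1[OF that])
    also have "\<dots> = (\<Sum>i\<in>UNIV. \<phi> x i *\<^sub>R (v x i - h x))"
      by (simp add: scaleR_sum_left sum_subtractf scaleR_diff_right)
    finally have eq: "F x - h x = (\<Sum>i\<in>UNIV. \<phi> x i *\<^sub>R (v x i - h x))" .
    have "dist (F x) (h x) \<le> (\<Sum>i\<in>UNIV. norm (\<phi> x i *\<^sub>R (v x i - h x)))"
      unfolding dist_norm eq by (rule norm_sum)
    also have "\<dots> \<le> (\<Sum>i\<in>UNIV. \<phi> x i * (\<Lambda> * (D + r) + \<epsilon>))"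
    proof (rule sum_mono)
      fix i
      show "norm (\<phi> x i *\<^sub>R (v x i - h x)) \<le> \<phi> x i * (\<Lambda> * (D + r) + \<epsilon>)"
      proof (cases "b i x > 0")
        case True
        then show ?thesis using v_close[OF True] \<phi>0[OF that, of i]
          by (simp add: dist_norm mult_left_mono)
      next
        case False
        then have "\<phi> x i = 0" using b0[of i x] by (simp add: \<phi>_def)
        then show ?thesis by simp
      qed
    qed
    also have "\<dots> = \<Lambda> * (D + r) + \<epsilon>" by (simp add: \<phi>1[OF that] flip: sum_distrib_right)
    finally show ?thesis .
  qed
  have \<phi>_lip: "\<bar>\<phi> x i - \<phi> y i\<bar> \<le> 3 * (N + 1) / r * dist x y" if "x \<in> X" "y \<in> X" for x y i
  proof -
    have "\<bar>\<sigma> x - \<sigma> y\<bar> \<le> (\<Sum>i\<in>UNIV. \<bar>b i x - b i y\<bar>)"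
      unfolding \<sigma>_def sum_subtractf[symmetric] by (rule sum_abs)
    also have "\<dots> \<le> (\<Sum>i\<in>(UNIV::'m set). dist x y)"
      by (rule sum_mono) (simp add: b_def bump_lipschitz)
    finally have "\<bar>\<sigma> x - \<sigma> y\<bar> \<le> N * dist x y" by (simp add: N_def)
    then have "\<bar>\<phi> x i - \<phi> y i\<bar> \<le> (N + 1) * dist x y / \<sigma> x"
      unfolding \<phi>_def using that \<sigma>0 b0 b_le
      by (intro quotient_diff_le) (auto simp: b_def bump_lipschitz)
    also have "\<dots> \<le> (N + 1) * dist x y / (r / 3)"
      using \<sigma>[OF that(1)] r N by (intro divide_left_mono) auto
    finally show ?thesis by (simp add: field_simps)
  qed
  \<comment> \<open>The weights alone account for half of this; the full value also covers a jump of
    \<open>2 * Q\<close> over a distance \<open>r / 3\<close>.\<close>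
  define B where "B = 6 * (N + 1) * Q / r"
  have B: "3 * (N + 1) / r * dist x y * Q \<le> B * dist x y" for x y :: 'a
  proof -
    have "3 * (N + 1) / r * dist x y * Q = B * dist x y / 2"
      using r by (simp add: B_def field_simps)
    also have "B * dist x y / 2 \<le> B * dist x y"
    proof -
      have "B \<ge> 0" using r N Q by (simp add: B_def)
      then have "0 \<le> B * dist x y" by simp
      then show ?thesis by linarith
    qed
    finally show ?thesis .
  qed
  have summand: "norm (\<phi> x i *\<^sub>R v x i - \<phi> y i *\<^sub>R v y i) \<le> B * dist x y"
    if xy: "x \<in> X" "y \<in> X" for x y i
  proof -
    have same: "norm (\<phi> x i *\<^sub>R w - \<phi> y i *\<^sub>R w) \<le> B * dist x y" if "norm w \<le> Q" for w :: "real ^ 'm"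
    proof -
      have "norm (\<phi> x i *\<^sub>R w - \<phi> y i *\<^sub>R w) = \<bar>\<phi> x i - \<phi> y i\<bar> * norm w"
        by (simp flip: scaleR_diff_left)
      also have "\<dots> \<le> (3 * (N + 1) / r * dist x y) * Q"
        using \<phi>_lip[OF xy] that r N by (intro mult_mono) auto
      finally show ?thesis using B[of x y] by linarith
    qed
    \<comment> \<open>In the first three cases both terms can be written with a common vector, so
      only the weights vary; in the last the crude bound suffices.\<close>
    consider "b i x = 0" | "b i y = 0" | "b i x > 0" "b i y > 0" "dist x y < r / 3" | "dist x y \<ge> r / 3"
      using b0[of i x] b0[of i y] by linarith
    then show ?thesis
    proof cases
      case 1
      then show ?thesis using same[OF v_norm[of y i]] by (simp add: \<phi>_def)
    next
      case 2
      then show ?thesis using same[OF v_norm[of x i]] by (simp add: \<phi>_def)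
    next
      case 3
      then have "v y i = v x i" using sel_eq[OF 3] by (simp add: v_def)
      then show ?thesis using same[OF v_norm[of x i]] by simp
    next
      case 4
      have le: "norm (\<phi> z i *\<^sub>R v z i) \<le> 1 * Q" if "z \<in> X" for z
        using \<phi>0[OF that, of i] \<phi>_le1[OF that, of i] v_norm[of z i] unfolding norm_scaleR
        by (intro mult_mono) auto
      have "norm (\<phi> x i *\<^sub>R v x i - \<phi> y i *\<^sub>R v y i) \<le> 2 * Q"
        using le[OF xy(1)] le[OF xy(2)] norm_triangle_ineq4[of "\<phi> x i *\<^sub>R v x i" "\<phi> y i *\<^sub>R v y i"]
        by linarith
      also have "\<dots> \<le> B * (r / 3)" using r N Q by (simp add: B_def mult_right_mono)
      also have "\<dots> \<le> B * dist x y" using 4 r N Q by (intro mult_left_mono) (auto simp: B_def)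
      finally show ?thesis .
    qed
  qed
  have F3: "dist (F x) (F y) \<le> N * B * dist x y" if "x \<in> X" "y \<in> X" for x y
  proof -
    have "dist (F x) (F y) \<le> (\<Sum>i\<in>UNIV. norm (\<phi> x i *\<^sub>R v x i - \<phi> y i *\<^sub>R v y i))"
      unfolding F_def dist_norm sum_subtractf[symmetric] by (rule norm_sum)
    also have "\<dots> \<le> (\<Sum>i\<in>(UNIV::'m set). B * dist x y)"
      by (rule sum_mono) (rule summand[OF that])
    finally show ?thesis by (simp add: N_def)
  qed
  show ?thesis by (rule that[OF F1 F2 F3[unfolded B_def N_def]])
qed

lemma has_cover_at_scale_families:
  fixes X :: "'a::metric_space set"
  assumes "has_cover_at_scale X n C r" "CARD('m::finite) = n + 1"
  obtains \<U> :: "'m::finite \<Rightarrow> 'a set set" where "X = (\<Union>i. \<Union>(\<U> i))"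
    "\<And>i. r_disjoint r (\<U> i)"
    "\<And>i U x y. U \<in> \<U> i \<Longrightarrow> x \<in> U \<Longrightarrow> y \<in> U \<Longrightarrow> dist x y \<le> C * r"
proof -
  obtain \<U> :: "nat \<Rightarrow> 'a set set" where \<U>: "(\<Union>i\<in>{1..n+1}. \<Union>(\<U> i)) = X"
    "\<And>i. i \<in> {1..n+1} \<Longrightarrow> r_disjoint r (\<U> i)"
    "\<And>i U. i \<in> {1..n+1} \<Longrightarrow> U \<in> \<U> i \<Longrightarrow> bounded U \<and> diameter U \<le> C * r"
    using assms(1) unfolding has_cover_at_scale_def by blast
  obtain e where e: "bij_betw e (UNIV :: 'm set) {1..n+1}"
    using assms(2) finite_same_card_bij[of "UNIV :: 'm set" "{1..n+1}"] by auto
  then have range: "e i \<in> {1..n+1}" for i by (auto simp: bij_betw_def)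
  have "X = (\<Union>i. \<Union>(\<U> (e i)))"
    using \<U>(1) e unfolding bij_betw_def by (metis image_image)
  moreover have "dist x y \<le> C * r" if "U \<in> \<U> (e i)" "x \<in> U" "y \<in> U" for i U x y
    using \<U>(3)[OF range that(1)] diameter_bounded_bound[OF _ that(2,3)] by linarith
  ultimately show ?thesis using \<U>(2)[OF range] by (intro that[of "\<lambda>i. \<U> (e i)"])
qed

text \<open>The nets, and with them \<open>\<theta>\<close> and \<open>K\<close>, are fixed before
  \<open>X\<close> and \<open>L\<close>, which makes the estimate uniform over all scales.\<close>

lemma sphere_extension_from_cover:
  assumes card: "CARD('m::finite) = n + 1" and C: "C > 0"
  obtains K \<theta> where "K > 0" "\<theta> > 0"
    "\<And>(X :: 'a::metric_space set) L. L > 0 \<Longrightarrow> has_cover_at_scale X n C (\<theta> / L) \<Longrightarrow>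
      lipschitz_extension_property X (sphere (0 :: real ^ 'm) 1) K L"
proof -
  define N where "N = real CARD('m)"
  have N: "N \<ge> 1" by (simp add: N_def Suc_leI)
  obtain V :: "'m \<Rightarrow> (real ^ 'm) set" and \<eta> where \<eta>: "\<eta> > 0" and
    V: "\<And>i z. norm z \<le> N \<Longrightarrow> \<exists>v\<in>V i. dist z v \<le> 1 / 8"
       "\<And>i v. v \<in> V i \<Longrightarrow> norm v \<le> N + 1 / 8"
       "\<And>v \<phi>. (\<And>i. v i \<in> V i) \<Longrightarrow> (\<Sum>i\<in>UNIV. \<phi> i) = 1 \<Longrightarrow> norm (\<Sum>i\<in>UNIV. \<phi> i *\<^sub>R v i) \<ge> \<eta>"
    by (rule generic_nets_lower_bound[of "1 / 8" N, where 'm = 'm]) auto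
  \<comment> \<open>At scale \<open>\<theta> / L\<close> the oscillation of \<open>h\<close> over a
    set and its margin is \<open>1 / 8\<close>; with the rounding error \<open>1 / 8\<close>,
    \<open>F\<close> stays within \<open>1 / 4\<close> of \<open>h\<close>.\<close>
  define \<theta> where "\<theta> = 1 / (8 * N * (C + 1))"
  have \<theta>: "\<theta> > 0" using N C by (simp add: \<theta>_def)
  define P where "P = N * (6 * (N + 1) * (N + 1 / 8)) / \<theta>"
  have P: "P > 0" using N \<theta> by (simp add: P_def)
  \<comment> \<open>The bound \<open>\<eta>\<close> applies where the interpolation equals
    \<open>F\<close>; elsewhere \<open>norm (h x) \<ge> 1 / 2\<close> and the correction is at most
    \<open>1 / 4\<close>.\<close>
  define \<mu> where "\<mu> = min (1 / 4) \<eta>"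
  have \<mu>: "\<mu> > 0" "\<mu> \<le> 1 / 4" "\<mu> \<le> \<eta>" using \<eta> by (auto simp: \<mu>_def)
  \<comment> \<open>The factor \<open>2 / \<mu>\<close> comes from the projection; \<open>N\<close>,
    \<open>2 * N\<close> and \<open>P\<close> come from \<open>h\<close>, the cutoff
    \<open>u\<close> and \<open>F\<close>.\<close>
  define K where "K = 2 / \<mu> * (3 * N + P)"
  have K: "K > 0" using \<mu> N P by (simp add: K_def add_pos_pos)
  have "\<exists>g. g \<in> X \<rightarrow> sphere (0 :: real ^ 'm) 1 \<and> (K * L)-lipschitz_on X g \<and> (\<forall>x\<in>A. g x = f x)"
    if L: "L > 0" and cover: "has_cover_at_scale X n C (\<theta> / L)"
      and A: "A \<subseteq> X" and f: "f \<in> A \<rightarrow> sphere (0 :: real ^ 'm) 1" "L-lipschitz_on A f"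
    for X A :: "'a set" and L f
  proof (cases "A = {}")
    case True
    \<comment> \<open>With no prescribed values an arbitrary constant unit vector serves; the
      distance to \<open>A\<close> would be degenerate.\<close>
    have "0-lipschitz_on X (\<lambda>_. axis (undefined :: 'm) (1::real))" by (rule lipschitz_on_constant)
    then have "(K * L)-lipschitz_on X (\<lambda>_. axis (undefined :: 'm) (1::real))"
      by (rule lipschitz_on_mono) (use K L in auto)
    then show ?thesis using True by (intro exI[of _ "\<lambda>_. axis undefined 1"]) (simp add: norm_axis_1)
  next
    case False
    define r where "r = \<theta> / L"
    have r: "r > 0" using \<theta> L by (simp add: r_def)
    have f1: "norm (f x) = 1" if "x \<in> A" for x using f(1) that by auto
    obtain h where h: "(N * L)-lipschitz_on UNIV h" "\<And>x. x \<in> A \<Longrightarrow> h x = f x" "\<And>x. norm (h x) \<le> N"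
      unfolding N_def by (rule lipschitz_extension_vec[OF f(2) False]) (use f1 in auto)
    obtain \<U> :: "'m \<Rightarrow> 'a set set" where \<U>: "X = (\<Union>i. \<Union>(\<U> i))"
      "\<And>i. r_disjoint r (\<U> i)"
      "\<And>i U x y. U \<in> \<U> i \<Longrightarrow> x \<in> U \<Longrightarrow> y \<in> U \<Longrightarrow> dist x y \<le> C * r"
      by (rule has_cover_at_scale_families[OF cover card]) (auto simp: r_def)
    obtain F where F: "\<And>x. x \<in> X \<Longrightarrow> norm (F x) \<ge> \<eta>"
      "\<And>x. x \<in> X \<Longrightarrow> dist (F x) (h x) \<le> (N * L) * (C * r + r) + 1 / 8"
      "\<And>x y. x \<in> X \<Longrightarrow> y \<in> X \<Longrightarrow>
        dist (F x) (F y) \<le> real CARD('m) * (6 * (real CARD('m) + 1) * (N + 1 / 8) / r) * dist x y"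
    proof (rule generic_approximation[OF r \<U>(1,2) _ h(3,1)])
      show "dist x y \<le> C * r" if "U \<in> \<U> i" "x \<in> U" "y \<in> U" for i U x y
        using that by (rule \<U>(3))
      show "\<exists>v\<in>V i. dist z v \<le> 1 / 8" if "norm z \<le> N" for i z
        using that by (rule V(1))
      show "norm v \<le> N + 1 / 8" if "v \<in> V i" for i v
        using that by (rule V(2))
      show "\<eta> \<le> norm (\<Sum>i\<in>UNIV. \<phi> i *\<^sub>R v i)" if "\<And>i. v i \<in> V i" "(\<Sum>i\<in>UNIV. \<phi> i) = 1" for v \<phi>
        using that by (rule V(3))
    qed (rule that)
    have "(N * L) * (C * r + r) = N * \<theta> * (C + 1)" using L by (simp add: r_def field_simps)
    also have "\<dots> = 1 / 8" using N C by (simp add: \<theta>_def)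
    finally have F2: "norm (F x - h x) \<le> 1 / 4" if "x \<in> X" for x
      using F(2)[OF that] by (simp add: dist_norm)
    have F3: "norm (F x - F y) \<le> P * L * dist x y" if "x \<in> X" "y \<in> X" for x y
      using F(3)[OF that, folded N_def] L \<theta> by (simp add: P_def r_def dist_norm)
    have h_lip: "norm (h x - h y) \<le> N * L * dist x y" for x y
      using h(1) by (auto simp: lipschitz_on_def dist_norm)
    \<comment> \<open>Where \<open>u < 1\<close>, some point of \<open>A\<close> is so close that \<open>norm (h x) \<ge> 1 / 2\<close>.\<close>
    define \<kappa> where "\<kappa> = 2 * N * L"
    have \<kappa>: "\<kappa> > 0" using N L by (simp add: \<kappa>_def)
    define u where "u x = min 1 (\<kappa> * infdist x A)" for x
    have u: "0 \<le> u x" "u x \<le> 1" for x using \<kappa> infdist_nonneg[of x A] by (auto simp: u_def)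
    have u_lip: "\<bar>u x - u y\<bar> \<le> \<kappa> * dist x y" for x y
    proof -
      have "\<bar>u x - u y\<bar> \<le> \<bar>\<kappa> * infdist x A - \<kappa> * infdist y A\<bar>" unfolding u_def by linarith
      also have "\<dots> = \<kappa> * \<bar>infdist x A - infdist y A\<bar>"
        using \<kappa> by (simp add: abs_mult flip: right_diff_distrib)
      also have "\<dots> \<le> \<kappa> * dist x y" using \<kappa> infdist_triangle_abs by (intro mult_left_mono) auto
      finally show ?thesis .
    qed
    define H where "H x = h x + u x *\<^sub>R (F x - h x)" for x
    have H_norm: "norm (H x) \<ge> \<mu>" if "x \<in> X" for x
    proof (cases "u x = 1")
      case True
      then show ?thesis using F(1)[OF that] \<mu> by (simp add: H_def)
    next
      case False
      then have "infdist x A < 1 / \<kappa>" using \<kappa> by (auto simp: u_def min_def field_simps split: if_splits)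
      then obtain a where a: "a \<in> A" "dist x a < 1 / \<kappa>"
        using \<open>A \<noteq> {}\<close> by (metis infdist_notempty cINF_less_iff bdd_belowI2 zero_le_dist)
      have "norm (h a - h x) \<le> N * L * dist a x" by (rule h_lip)
      also have "\<dots> \<le> N * L * (1 / \<kappa>)" using a(2) N L by (intro mult_left_mono) (auto simp: dist_commute)
      also have "\<dots> = 1 / 2" using N L by (simp add: \<kappa>_def)
      finally have "norm (h x) \<ge> 1 / 2"
        using f1[OF a(1)] h(2)[OF a(1)] norm_triangle_ineq2[of "h a" "h x"] by simp
      moreover have "norm (u x *\<^sub>R (F x - h x)) \<le> 1 * (1 / 4)"
        unfolding norm_scaleR using u[of x] F2[OF that] by (intro mult_mono) auto
      ultimately have "norm (H x) \<ge> 1 / 4"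
        using norm_diff_ineq[of "h x" "u x *\<^sub>R (F x - h x)"] by (simp add: H_def)
      then show ?thesis using \<mu> by linarith
    qed
    have H_lip: "dist (H x) (H y) \<le> (3 * N + P) * L * dist x y" if "x \<in> X" "y \<in> X" for x y
    proof -
      have tri: "norm (a + b + c) \<le> norm a + norm b + norm c" for a b c :: "real ^ 'm"
        using norm_triangle_ineq[of "a + b" c] norm_triangle_ineq[of a b] by linarith
      have eq: "H x - H y = (1 - u x) *\<^sub>R (h x - h y) + u x *\<^sub>R (F x - F y) + (u x - u y) *\<^sub>R (F y - h y)"
        by (simp add: H_def algebra_simps)
      have "dist (H x) (H y) \<le> norm ((1 - u x) *\<^sub>R (h x - h y)) + norm (u x *\<^sub>R (F x - F y))
          + norm ((u x - u y) *\<^sub>R (F y - h y))"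
        unfolding dist_norm eq by (rule tri)
      moreover have "norm ((1 - u x) *\<^sub>R (h x - h y)) \<le> 1 * (N * L * dist x y)"
        unfolding norm_scaleR using u[of x] h_lip by (intro mult_mono) auto
      moreover have "norm (u x *\<^sub>R (F x - F y)) \<le> 1 * (P * L * dist x y)"
        unfolding norm_scaleR using u[of x] F3[OF that] by (intro mult_mono) auto
      moreover have "norm ((u x - u y) *\<^sub>R (F y - h y)) \<le> (\<kappa> * dist x y) * 1"
        unfolding norm_scaleR using u_lip[of x y] F2[OF that(2)] \<kappa> by (intro mult_mono) auto
      ultimately show ?thesis by (simp add: \<kappa>_def algebra_simps)
    qed
    have "(K * L)-lipschitz_on X (\<lambda>x. sgn (H x))"
    proof (rule lipschitz_onI)
      fix x y assume xy: "x \<in> X" "y \<in> X"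
      have "dist (sgn (H x)) (sgn (H y)) \<le> 2 / \<mu> * dist (H x) (H y)"
        using \<mu>(1) H_norm[OF xy(1)] by (rule dist_sgn_le)
      also have "\<dots> \<le> 2 / \<mu> * ((3 * N + P) * L * dist x y)"
        using H_lip[OF xy] \<mu>(1) by (intro mult_left_mono) auto
      finally show "dist (sgn (H x)) (sgn (H y)) \<le> K * L * dist x y"
        by (simp only: K_def mult.assoc)
    qed (use K L in simp)
    moreover have "(\<lambda>x. sgn (H x)) \<in> X \<rightarrow> sphere 0 1"
    proof
      fix x assume "x \<in> X"
      then have "H x \<noteq> 0" using H_norm[of x] \<mu>(1) by auto
      then show "sgn (H x) \<in> sphere 0 1" by (simp add: norm_sgn)
    qed
    moreover have "sgn (H x) = f x" if "x \<in> A" for x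
      using h(2)[OF that] f1[OF that] that by (simp add: H_def u_def sgn_div_norm)
    ultimately show ?thesis by blast
  qed
  then have "lipschitz_extension_property X (sphere (0 :: real ^ 'm) 1) K L"
    if "L > 0" "has_cover_at_scale X n C (\<theta> / L)" for X :: "'a set" and L
    unfolding lipschitz_extension_property_def using that by blast
  then show ?thesis using that K \<theta> by blast
qed

section \<open>Changing the scale\<close>

lemma bounded_diameter_le:
  fixes V :: "'a::metric_space set"
  assumes "\<And>x y. x \<in> V \<Longrightarrow> y \<in> V \<Longrightarrow> dist x y \<le> D" "D \<ge> 0"
  shows "bounded V \<and> diameter V \<le> D"
proof
  show "bounded V" using assms(1) unfolding bounded_two_points by blast
  show "diameter V \<le> D"
  proof (cases "V = {}")
    case False
    then have "(SUP (x, y)\<in>V \<times> V. dist x y) \<le> D" using assms(1) by (intro cSUP_least) auto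
    then show ?thesis using False by (simp add: diameter_def)
  qed (use assms(2) in simp)
qed

lemma UN_atLeastAtMost_split:
  fixes a b :: nat
  assumes "a \<le> b"
  shows "(\<Union>i\<in>{1..b}. f i) = (\<Union>i\<in>{1..a}. f i) \<union> (\<Union>i\<in>{Suc a..b}. f i)"
proof -
  have "{1..b} = {1..a} \<union> {Suc a..b}" using assms by auto
  then show ?thesis by (simp only: UN_Un)
qed

text \<open>The first \<open>n + 2\<close> colours are reduced and the others kept, as
  \<open>c \<le> 1\<close> preserves their disjointness. Sizes up to \<open>(D + 1) * r\<close>,
  measured at the new scale \<open>c * r\<close>, give the ratio \<open>(D + 1) / c\<close>.\<close>

lemma has_cover_at_scale_drop:
  fixes X :: "'a::metric_space set"
  assumes card: "CARD('m::finite) = n + 1"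
    and ext: "lipschitz_extension_property X (sphere (0 :: real ^ 'm) 1) C (24 * (n + 1) / r)"
    and cover: "has_cover_at_scale X (n + Suc j) D r"
    and pos: "C > 0" "D > 0" "r > 0"
  defines "c \<equiv> disjointness_factor (n + 1) C"
  shows "has_cover_at_scale X (n + j) ((D + 1) / c) (c * r)"
proof -
  have c: "c > 0" "c \<le> 1" using disjointness_factor_bounds[of "n + 1" C] pos by (auto simp: c_def)
  obtain \<U> :: "nat \<Rightarrow> 'a set set" where \<U>: "(\<Union>i\<in>{1..n + Suc j + 1}. \<Union>(\<U> i)) = X"
    "\<And>i. i \<in> {1..n + Suc j + 1} \<Longrightarrow> r_disjoint r (\<U> i)"
    "\<And>i U. i \<in> {1..n + Suc j + 1} \<Longrightarrow> U \<in> \<U> i \<Longrightarrow> bounded U \<and> diameter U \<le> D * r"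
    using cover unfolding has_cover_at_scale_def by blast
  obtain e where e: "bij_betw e (UNIV :: 'm option set) {1..n+2}"
    using card finite_same_card_bij[of "UNIV :: 'm option set" "{1..n+2}"] by auto
  have range: "e i \<in> {1..n + Suc j + 1}" for i
    using bij_betwE[OF e] by fastforce
  define Y where "Y = (\<Union>i. \<Union>(\<U> (e i)))"
  have Y: "Y = (\<Union>i\<in>{1..n+2}. \<Union>(\<U> i))"
    using e unfolding Y_def bij_betw_def by (metis image_image)
  have XY: "X = Y \<union> (\<Union>i\<in>{Suc (n+2)..n + Suc j + 1}. \<Union>(\<U> i))"
    unfolding Y \<U>(1)[symmetric] by (rule UN_atLeastAtMost_split) simp
  then have YX: "Y \<subseteq> X" by blast
  have dist_U: "dist x y \<le> D * r" if "U \<in> \<U> i" "x \<in> U" "y \<in> U" "i \<in> {1..n + Suc j + 1}" for i U x y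
    using \<U>(3)[OF that(4,1)] diameter_bounded_bound[OF _ that(2,3)] by linarith
  have ext': "lipschitz_extension_property X (sphere (0 :: real ^ 'm) 1) C (24 * CARD('m) / r)"
    using ext card by (simp add: add.commute)
  have dist_Ue: "dist x y \<le> D * r" if "U \<in> \<U> (e i)" "x \<in> U" "y \<in> U" for i U x y
    using that range by (rule dist_U)
  have Y_cover: "Y \<subseteq> (\<Union>i. \<Union>(\<U> (e i)))" by (simp add: Y_def)
  obtain \<V> :: "nat \<Rightarrow> 'a set set" where \<V>: "(\<Union>k\<in>{1..CARD('m)}. \<Union>(\<V> k)) = Y"
    "\<And>k. r_disjoint (disjointness_factor CARD('m) C * r) (\<V> k)"
    "\<And>k V x y. V \<in> \<V> k \<Longrightarrow> x \<in> V \<Longrightarrow> y \<in> V \<Longrightarrow> dist x y \<le> D * r + r"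
    by (rule reduce_families[OF ext' pos(1,3) YX Y_cover \<U>(2)[OF range]])
       (rule dist_Ue, assumption+, rule that)
  \<comment> \<open>One colour has gone, so the untouched families move down by one index.\<close>
  define \<W> where "\<W> i = (if i \<le> n + 1 then \<V> i else \<U> (i + 1))" for i
  have "(\<Union>i\<in>{1..n+j+1}. \<Union>(\<W> i)) = X"
  proof -
    have "(\<Union>i\<in>{1..n+j+1}. \<Union>(\<W> i)) =
        (\<Union>i\<in>{1..n+1}. \<Union>(\<W> i)) \<union> (\<Union>i\<in>{Suc (n+1)..n+j+1}. \<Union>(\<W> i))"
      by (rule UN_atLeastAtMost_split) simp
    also have "(\<Union>i\<in>{1..n+1}. \<Union>(\<W> i)) = (\<Union>i\<in>{1..n+1}. \<Union>(\<V> i))"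
      by (intro SUP_cong) (simp_all add: \<W>_def)
    also have "\<dots> = Y" using \<V>(1) card by simp
    also have "(\<Union>i\<in>{Suc (n+1)..n+j+1}. \<Union>(\<W> i)) = (\<Union>i\<in>{Suc (n+1)..n+j+1}. \<Union>(\<U> (Suc i)))"
      by (intro SUP_cong) (simp_all add: \<W>_def)
    also have "\<dots> = (\<Union>i\<in>Suc ` {Suc (n+1)..n+j+1}. \<Union>(\<U> i))" by (simp only: image_image)
    also have "Suc ` {Suc (n+1)..n+j+1} = {Suc (n+2)..n + Suc j + 1}"
      by (simp only: image_Suc_atLeastAtMost) simp
    also note XY[symmetric]
    finally show ?thesis .
  qed
  moreover have "r_disjoint (c * r) (\<W> i)" if "i \<in> {1..n+j+1}" for i
  proof (cases "i \<le> n + 1")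
    case True
    then show ?thesis using \<V>(2)[of i] card by (simp add: \<W>_def c_def)
  next
    case False
    have "c * r \<le> r" using c pos by simp
    moreover have "r_disjoint r (\<U> (i + 1))" using \<U>(2)[of "i + 1"] that by simp
    ultimately show ?thesis using False unfolding \<W>_def r_disjoint_def by fastforce
  qed
  moreover have "bounded W \<and> diameter W \<le> (D + 1) / c * (c * r)" if "i \<in> {1..n+j+1}" "W \<in> \<W> i" for i W
  proof (rule bounded_diameter_le)
    have eq: "(D + 1) / c * (c * r) = D * r + r" using c by (simp add: field_simps)
    show "0 \<le> (D + 1) / c * (c * r)" using c pos by simp
    fix x y assume "x \<in> W" "y \<in> W"
    then show "dist x y \<le> (D + 1) / c * (c * r)"
      unfolding eq using \<V>(3)[of W i x y] dist_U[of W "i + 1" x y] that pos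
      by (force simp: \<W>_def split: if_splits)
  qed
  ultimately show ?thesis unfolding has_cover_at_scale_def by blast
qed

lemma has_cover_at_scale_mono:
  assumes "has_cover_at_scale X k C r" "k \<le> n"
  shows "has_cover_at_scale X n C r"
proof -
  obtain \<U> where \<U>: "(\<Union>i\<in>{1..k+1}. \<Union>(\<U> i)) = X"
    "\<And>i. i \<in> {1..k+1} \<Longrightarrow> r_disjoint r (\<U> i) \<and> (\<forall>U\<in>\<U> i. bounded U \<and> diameter U \<le> C * r)"
    using assms(1) unfolding has_cover_at_scale_def by blast
  define \<W> where "\<W> i = (if i \<le> k + 1 then \<U> i else {})" for i
  have "(\<Union>i\<in>{1..n+1}. \<Union>(\<W> i)) = X"
  proof -
    have "(\<Union>i\<in>{1..n+1}. \<Union>(\<W> i)) =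
        (\<Union>i\<in>{1..k+1}. \<Union>(\<W> i)) \<union> (\<Union>i\<in>{Suc (k+1)..n+1}. \<Union>(\<W> i))"
      by (rule UN_atLeastAtMost_split) (use assms(2) in simp)
    also have "(\<Union>i\<in>{1..k+1}. \<Union>(\<W> i)) = (\<Union>i\<in>{1..k+1}. \<Union>(\<U> i))"
      by (intro SUP_cong) (simp_all add: \<W>_def)
    also have "(\<Union>i\<in>{Suc (k+1)..n+1}. \<Union>(\<W> i)) = {}" by (simp add: \<W>_def)
    finally show ?thesis using \<U>(1) by simp
  qed
  moreover have "r_disjoint r (\<W> i) \<and> (\<forall>U\<in>\<W> i. bounded U \<and> diameter U \<le> C * r)" if "i \<in> {1..n+1}" for i
    using \<U>(2)[of i] that by (auto simp: \<W>_def r_disjoint_def)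
  ultimately show ?thesis unfolding has_cover_at_scale_def by blast
qed

text \<open>Constants below a positive bound include those not of the form \<open>1 / r\<close> with
  \<open>r > 0\<close>. A negative one admits no Lipschitz map, and 0 only constant maps.\<close>

lemma lipschitz_extension_property_nonpos:
  assumes "L \<le> 0" "E \<noteq> {}"
  shows "lipschitz_extension_property X E C L"
  unfolding lipschitz_extension_property_def
proof (intro allI impI, elim conjE)
  fix A f assume A: "A \<subseteq> X" "f \<in> A \<rightarrow> E" "L-lipschitz_on A f"
  then have L: "L = 0" using assms(1) by (auto simp: lipschitz_on_def)
  obtain p where p: "p \<in> E" "\<And>x. x \<in> A \<Longrightarrow> f x = p"
  proof (cases "A = {}")
    case True
    then show ?thesis using assms(2) that by blast
  next
    case False
    then obtain a where "a \<in> A" by blast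
    moreover have "f x = f a" if "x \<in> A" for x
      using lipschitz_onD[OF A(3) that \<open>a \<in> A\<close>] L by simp
    ultimately show ?thesis using that A(2) by blast
  qed
  then show "\<exists>g. g \<in> X \<rightarrow> E \<and> (C * L)-lipschitz_on X g \<and> (\<forall>x\<in>A. g x = f x)"
    using L by (intro exI[of _ "\<lambda>_. p"]) (auto intro: lipschitz_on_constant)
qed

section \<open>Small and large scales treated together as filters\<close>

definition dim_le_along :: "real filter \<Rightarrow> 'a::metric_space set \<Rightarrow> nat \<Rightarrow> bool" where
  "dim_le_along F X n \<longleftrightarrow> (\<exists>C>0. \<forall>\<^sub>F r in F. has_cover_at_scale X n C r)"

text \<open>With the constant \<open>1 / r\<close>, large Lipschitz constants correspond to small
  \<open>r\<close>, so extensors and dimension run along the same filter.\<close>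

definition extensor_along :: "real filter \<Rightarrow> 'b::metric_space set \<Rightarrow> 'a::metric_space set \<Rightarrow> bool" where
  "extensor_along F E X \<longleftrightarrow> (\<exists>C>0. \<forall>\<^sub>F r in F. lipschitz_extension_property X E C (1 / r))"

lemma small_scale_lipschitz_extensor_iff:
  "small_scale_lipschitz_extensor E X \<longleftrightarrow> extensor_along (at_right 0) E X"
proof -
  have "(\<exists>M>0. \<forall>L>M. lipschitz_extension_property X E C L) \<longleftrightarrow>
      (\<forall>\<^sub>F r in at_right 0. lipschitz_extension_property X E C (1 / r))" for C
  proof
    assume "\<exists>M>0. \<forall>L>M. lipschitz_extension_property X E C L"
    then obtain M where M: "M > 0" "\<And>L. L > M \<Longrightarrow> lipschitz_extension_property X E C L" by blast
    have "lipschitz_extension_property X E C (1 / r)" if "0 < r" "r < 1 / M" for r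
      using that M(1) by (intro M(2)) (simp add: field_simps)
    then show "\<forall>\<^sub>F r in at_right 0. lipschitz_extension_property X E C (1 / r)"
      using M(1) by (auto simp: eventually_at_right_field intro!: exI[of _ "1 / M"])
  next
    assume "\<forall>\<^sub>F r in at_right 0. lipschitz_extension_property X E C (1 / r)"
    then obtain b where b: "b > 0" "\<And>r. 0 < r \<Longrightarrow> r < b \<Longrightarrow> lipschitz_extension_property X E C (1 / r)"
      by (auto simp: eventually_at_right_field)
    have "lipschitz_extension_property X E C L" if "L > 1 / b" for L
    proof -
      have "1 / b > 0" using b(1) by simp
      then have "L > 0" using that by linarith
      then show ?thesis using b(2)[of "1 / L"] b(1) that by (simp add: field_simps)
    qed
    then show "\<exists>M>0. \<forall>L>M. lipschitz_extension_property X E C L"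
      using b(1) by (intro exI[of _ "1 / b"]) simp
  qed
  then show ?thesis by (simp add: small_scale_lipschitz_extensor_def extensor_along_def)
qed

lemma large_scale_lipschitz_extensor_iff:
  assumes "E \<noteq> {}"
  shows "large_scale_lipschitz_extensor E X \<longleftrightarrow> extensor_along at_top E X"
proof -
  have "(\<exists>M>0. \<forall>L<M. lipschitz_extension_property X E C L) \<longleftrightarrow>
      (\<forall>\<^sub>F r in at_top. lipschitz_extension_property X E C (1 / r))" for C
  proof
    assume "\<exists>M>0. \<forall>L<M. lipschitz_extension_property X E C L"
    then obtain M where M: "M > 0" "\<And>L. L < M \<Longrightarrow> lipschitz_extension_property X E C L" by blast
    have "\<forall>\<^sub>F r in at_top. r > 1 / M" by (rule eventually_gt_at_top)
    then show "\<forall>\<^sub>F r in at_top. lipschitz_extension_property X E C (1 / r)"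
    proof eventually_elim
      case (elim r)
      have "1 / M > 0" using M(1) by simp
      then have "r > 0" using elim by linarith
      then show ?case using elim M(1) by (intro M(2)) (simp add: field_simps)
    qed
  next
    assume "\<forall>\<^sub>F r in at_top. lipschitz_extension_property X E C (1 / r)"
    then obtain b where b: "\<And>r. b \<le> r \<Longrightarrow> lipschitz_extension_property X E C (1 / r)"
      by (auto simp: eventually_at_top_linorder)
    \<comment> \<open>The maximum with 1 makes the threshold positive, so that \<open>1 / b'\<close>
      is an admissible bound.\<close>
    define b' where "b' = max 1 b"
    have "b' > 0" by (simp add: b'_def)
    have "lipschitz_extension_property X E C L" if "L < 1 / b'" for L
    proof (cases "L > 0")
      case True
      then have "b' \<le> 1 / L" using that \<open>b' > 0\<close> by (simp add: field_simps)
      then show ?thesis using b[of "1 / L"] by (simp add: b'_def)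
    next
      case False
      then show ?thesis using assms by (intro lipschitz_extension_property_nonpos) auto
    qed
    then show "\<exists>M>0. \<forall>L<M. lipschitz_extension_property X E C L"
      using \<open>b' > 0\<close> by (intro exI[of _ "1 / b'"]) simp
  qed
  then show ?thesis by (simp add: large_scale_lipschitz_extensor_def extensor_along_def)
qed

text \<open>Invariance of the filter under scaling by positive constants absorbs every fixed factor
  (\<open>\<theta>\<close>, \<open>K\<close>, \<open>c\<close>) lost in the single-scale
  estimates.\<close>

lemma extensor_along_iff_dim_le_along:
  fixes X :: "'a::metric_space set"
  assumes card: "CARD('m::finite) = n + 1"
    and F_pos: "\<forall>\<^sub>F r in F. r > 0"
    and F_scale: "\<And>c. c > 0 \<Longrightarrow> filterlim (\<lambda>r. c * r) F F"
    and dim: "dim_le_along F X k"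
  shows "extensor_along F (sphere (0 :: real ^ 'm) 1) X \<longleftrightarrow> dim_le_along F X n"
proof
  have rescale: "\<forall>\<^sub>F r in F. P (c * r)" if "\<forall>\<^sub>F r in F. P r" "c > 0" for P and c :: real
    using eventually_compose_filterlim[OF that(1) F_scale[OF that(2)]] .
  {
    assume "dim_le_along F X n"
    then obtain C where C: "C > 0" "\<forall>\<^sub>F r in F. has_cover_at_scale X n C r"
      unfolding dim_le_along_def by blast
    obtain K \<theta> where K: "K > 0" "\<theta> > 0"
      "\<And>(X :: 'a set) L. L > 0 \<Longrightarrow> has_cover_at_scale X n C (\<theta> / L) \<Longrightarrow>
        lipschitz_extension_property X (sphere (0 :: real ^ 'm) 1) K L"
      by (rule sphere_extension_from_cover[OF card C(1), where 'a = 'a]) (rule that)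
    have "\<forall>\<^sub>F r in F. lipschitz_extension_property X (sphere (0 :: real ^ 'm) 1) K (1 / r)"
      using F_pos rescale[OF C(2) K(2)]
      by eventually_elim (rule K(3), simp_all)
    then show "extensor_along F (sphere (0 :: real ^ 'm) 1) X"
      unfolding extensor_along_def using K(1) by blast
  }
  assume "extensor_along F (sphere (0 :: real ^ 'm) 1) X"
  then obtain C where C: "C > 0"
    "\<forall>\<^sub>F r in F. lipschitz_extension_property X (sphere (0 :: real ^ 'm) 1) C (1 / r)"
    unfolding extensor_along_def by blast
  define K where "K = 24 * (real n + 1)"
  have K: "K > 0" by (simp add: K_def)
  have ext: "\<forall>\<^sub>F r in F. lipschitz_extension_property X (sphere (0 :: real ^ 'm) 1) C (K / r)"
    using rescale[OF C(2), of "1 / K"] K by simp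
  have step: "dim_le_along F X (n + j)" if dim: "dim_le_along F X (n + Suc j)" for j
  proof -
    obtain D where D: "D > 0" "\<forall>\<^sub>F r in F. has_cover_at_scale X (n + Suc j) D r"
      using dim unfolding dim_le_along_def by blast
    define c where "c = disjointness_factor (n + 1) C"
    have c: "c > 0" using disjointness_factor_bounds[of "n + 1" C] C(1) by (simp add: c_def)
    have "\<forall>\<^sub>F r in F. has_cover_at_scale X (n + j) ((D + 1) / c) (c * r)"
      using F_pos D(2) ext
    proof eventually_elim
      case (elim r)
      show ?case unfolding c_def
        by (rule has_cover_at_scale_drop[OF card _ elim(2) C(1) D(1) elim(1)])
           (use elim(3) in \<open>simp add: K_def add.commute\<close>)
    qed
    from rescale[OF this, of "1 / c"] c
    have "\<forall>\<^sub>F r in F. has_cover_at_scale X (n + j) ((D + 1) / c) r" by simp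
    moreover have "(D + 1) / c > 0" using c D(1) by simp
    ultimately show ?thesis unfolding dim_le_along_def by blast
  qed
  have down: "dim_le_along F X (n + j) \<Longrightarrow> dim_le_along F X n" for j
    by (induction j) (use step in auto)
  \<comment> \<open>Padding the \<open>k + 1\<close> colours with empty families to
    \<open>n + k + 1\<close> avoids comparing \<open>k\<close> with \<open>n\<close>;
    \<open>k\<close> removals then lead to dimension \<open>n\<close>.\<close>
  obtain D where D: "D > 0" "\<forall>\<^sub>F r in F. has_cover_at_scale X k D r"
    using dim unfolding dim_le_along_def by blast
  have "\<forall>\<^sub>F r in F. has_cover_at_scale X (n + k) D r"
    using D(2) by eventually_elim (erule has_cover_at_scale_mono, simp)
  with D(1) have "dim_le_along F X (n + k)" unfolding dim_le_along_def by blast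
  then show "dim_le_along F X n" by (rule down)
qed

theorem theorem4p2:
  fixes X :: "'a::metric_space set" and n :: nat
  assumes "CARD('m::finite) = n + 1"
  shows "(finite_capacity_dim X \<longrightarrow>
            (small_scale_lipschitz_extensor (sphere (0 :: real ^ 'm) 1) X \<longleftrightarrow> capacity_dim_le X n)) \<and>
         (finite_asdim_higson X \<longrightarrow>
            (large_scale_lipschitz_extensor (sphere (0 :: real ^ 'm) 1) X \<longleftrightarrow> asdim_higson_le X n))"
proof -
  have cap: "capacity_dim_le X k \<longleftrightarrow> dim_le_along (at_right 0) X k" for k
    by (simp add: capacity_dim_le_def dim_le_along_def)
  have asd: "asdim_higson_le X k \<longleftrightarrow> dim_le_along at_top X k" for k
    by (simp add: asdim_higson_le_def dim_le_along_def)
  have "filterlim (\<lambda>r. c * r) (at_right 0) (at_right 0)" if "c > 0" for c :: real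
    by (rule filterlim_times_pos[OF filterlim_ident that]) simp
  note small = extensor_along_iff_dim_le_along[OF assms eventually_at_right_less this]
  have "filterlim (\<lambda>r. c * r) at_top at_top" if "c > 0" for c :: real
    using filterlim_tendsto_pos_mult_at_top[OF tendsto_const that filterlim_ident] .
  note large = extensor_along_iff_dim_le_along[OF assms eventually_gt_at_top this]
  have "sphere (0 :: real ^ 'm) 1 \<noteq> {}" by simp
  then show ?thesis
    using small large
    by (auto simp: finite_capacity_dim_def finite_asdim_higson_def cap asd
        small_scale_lipschitz_extensor_iff large_scale_lipschitz_extensor_iff)
qed

end
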